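(* Let $d, p \in \mathbb{N}^+$ be fixed and let $\mathbf{C}(\mathbf{h}) = \{c_{k\ell}(\mathbf{h})\}_{1\le k,\ell\le p}$, $\mathbf{h}\in\mathbb{R}^d$, be the matrix covariance function of a zero-mean real-valued $p$-variate stationary random process on $\mathbb{R}^d$. Assume: (1) There exist finite constants $A>0$ and $\tau>0$ such that for all $1\le k,\ell\le p$ and all $\mathbf{x}\in\mathbb{R}^d$, $$|c_{k\ell}(\mathbf{x})| \le \frac{A}{1+|\mathbf{x}|^{d+\tau}}.$$ (2) For all $1\le k,\ell\le p$ and all $\mathbf{x}\in\mathbb{R}^d$, $$c_{k\ell}(\mathbf{x}) = \int_{\mathbb{R}^d} \hat{c}_{k\ell}(\mathbf{f})\, e^{\imath \mathbf{f}\cdot\mathbf{x}}\, d\mathbf{f},$$ and the Hermitian matrix $\hat{\mathbf{C}}(\mathbf{f}) = \{\hat{c}_{k\ell}(\mathbf{f})\}_{1\le k,\ell\le p}$ satisfies $\lambda_1\{\hat{\mathbf{C}}(\mathbf{f})\}>0$ for all $\mathbf{f}\in\mathbb{R}^d$. (3) $(\mathbf{x}^{(1)}_i)_{i\in\mathbb{N}^+},\dots,(\mathbf{x}^{(p)}_i)_{i\in\mathbb{N}^+}$ are $p$ sequences of points in $\mathbb{R}^d$ for which there exists a fixed $\Delta>0$ such that for all $1\le k\le p$, $\inf_{i,j\in\mathbb{N}^+;\, i\ne j} |\mathbf{x}^{(k)}_i-\mathbf{x}^{(k)}_j| \ge \Delta$. For $n_1,\dots,n_p\in\mathbb{N}^+$,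 let $N_0=0$, $N_k = n_1+\dots+n_k$ for $1\le k\le p$, $N=N_p$, and let $\boldsymbol{\Sigma}$ (depending on $n_1,\dots,n_p$) be the $N\times N$ matrix with entries $\sigma_{ab} = c_{k\ell}(\mathbf{x}^{(k)}_i-\mathbf{x}^{(\ell)}_j)$ for $a=N_{k-1}+i$, $b=N_{\ell-1}+j$, $1\le k,\ell\le p$, $1\le i\le n_k$, $1\le j\le n_\ell$. Then $$\inf_{n_1,\dots,n_p\in\mathbb{N}^+} \lambda_1(\boldsymbol{\Sigma}) > 0.$$
   Context: For a vector $\mathbf{x}\in\mathbb{C}^m$ (in particular $\mathbf{x}\in\mathbb{R}^m$), $|\mathbf{x}| = \max_{1\le i\le m}|x_i|$. For a Hermitian $m\times m$ matrix $\mathbf{M}$, $\lambda_1(\mathbf{M})\le\dots\le\lambda_m(\mathbf{M})$ denote its (real) eigenvalues, so $\lambda_1$ is the smallest eigenvalue. $\imath^2=-1$. The Fourier transform of $g:\mathbb{R}^d\to\mathbb{R}$ is $\hat g(\mathbf{f}) = (2\pi)^{-d}\int_{\mathbb{R}^d} g(\mathbf{x}) e^{-\imath\mathbf{f}\cdot\mathbf{x}}\,d\mathbf{x}$. The matrix covariance function of a zero-mean stationary process $\{Z_k(\mathbf{s}): \mathbf{s}\in\mathbb{R}^d, 1\le k\le p\}$ is given by $c_{k\ell}(\mathbf{s}-\mathbf{t}) = \mathrm{Cov}(Z_k(\mathbf{s}),Z_\ell(\mathbf{t}))$, assumed to depend only on $\mathbf{s}-\mathbf{t}$; thus $\boldsymbol{\Sigma}$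 is the covariance matrix of the vector of observations of each $Z_k$ at $\mathbf{x}^{(k)}_1,\dots,\mathbf{x}^{(k)}_{n_k}$. In particular the $c_{k\ell}$ are real-valued, $c_{k\ell}(-\mathbf{h})=c_{\ell k}(\mathbf{h})$, and $\boldsymbol{\Sigma}$ is real symmetric. Under the decay condition (1), each $\hat c_{k\ell}$ is well defined, continuous and bounded, and $\hat{\mathbf{C}}(\mathbf{f})$ is Hermitian for every $\mathbf{f}$. Points of different sequences (different $k$) are allowed to coincide. *)

theory Defs
  imports
    "HOL-Probability.Probability"
    "Jordan_Normal_Form.Char_Poly"
begin

definition covariance :: "'w measure \<Rightarrow> ('w \<Rightarrow> real) \<Rightarrow> ('w \<Rightarrow> real) \<Rightarrow> real" where
  "covariance M X Y =
     (LINT w|M. (X w - (LINT v|M. X v)) * (Y w - (LINT v|M. Y v)))"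

text \<open>\<open>c\<close> is the matrix covariance function of the zero-mean, second-order stationary,
  real-valued \<open>p\<close>-variate process \<open>Z\<close>. Components are numbered \<open>1, ..., p\<close>; values of \<open>c\<close> and \<open>Z\<close> at
  other indices are irrelevant. Stationarity is only required of the covariances, that is,
  they depend on the two sites through their difference.\<close>

definition is_matrix_covariance_function ::
  "'w measure \<Rightarrow> nat \<Rightarrow> (nat \<Rightarrow> 's::ab_group_add \<Rightarrow> 'w \<Rightarrow> real) \<Rightarrow> (nat \<Rightarrow> nat \<Rightarrow> 's \<Rightarrow> real) \<Rightarrow> bool"
where
  "is_matrix_covariance_function M p Z c \<longleftrightarrow>
     prob_space M \<and>
     (\<forall>k\<in>{1..p}. \<forall>s. Z k s \<in> borel_measurable M \<and> integrable M (\<lambda>w. (Z k s w)\<^sup>2) \<and>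
                     (LINT w|M. Z k s w) = 0) \<and>
     (\<forall>k\<in>{1..p}. \<forall>l\<in>{1..p}. \<forall>s t. covariance M (Z k s) (Z l t) = c k l (s - t))"

definition fourier :: "(real^'d \<Rightarrow> real) \<Rightarrow> real^'d \<Rightarrow> complex" where
  "fourier g f = complex_of_real (1 / (2 * pi) ^ CARD('d)) *
     (LINT x|lborel. complex_of_real (g x) * exp (- \<i> * complex_of_real (inner f x)))"

text \<open>Matrix rows and columns are numbered from \<open>0\<close>, the components of the process from \<open>1\<close>.\<close>

definition spectral_matrix ::
  "nat \<Rightarrow> (nat \<Rightarrow> nat \<Rightarrow> real^'d \<Rightarrow> real) \<Rightarrow> real^'d \<Rightarrow> complex mat" where
  "spectral_matrix p c f = mat p p (\<lambda>(k, l). fourier (c (k + 1) (l + 1)) f)"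

text \<open>The \<open>j\<close>-th smallest eigenvalue, \<open>j = 1, 2, ...\<close>, counted with multiplicity. This is meant for
  Hermitian matrices, all of whose eigenvalues are real, so that taking real parts loses nothing.\<close>

definition ordered_eigenvalue :: "nat \<Rightarrow> complex mat \<Rightarrow> real" where
  "ordered_eigenvalue j A =
     sorted_list_of_multiset (image_mset Re (proots (char_poly A))) ! (j - 1)"

definition block_end :: "(nat \<Rightarrow> nat) \<Rightarrow> nat \<Rightarrow> nat" where
  "block_end n k = (\<Sum>j = 1..k. n j)"

text \<open>For \<open>a = block_end n (k - 1) + i\<close> with \<open>1 \<le> i \<le> n k\<close>, the following two functions recover
  \<open>k\<close> and \<open>i\<close>.\<close>

definition block_index :: "(nat \<Rightarrow> nat) \<Rightarrow> nat \<Rightarrow> nat" where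
  "block_index n a = (LEAST k. a \<le> block_end n k)"

definition block_offset :: "(nat \<Rightarrow> nat) \<Rightarrow> nat \<Rightarrow> nat" where
  "block_offset n a = a - block_end n (block_index n a - 1)"

definition cov_matrix ::
  "nat \<Rightarrow> (nat \<Rightarrow> nat \<Rightarrow> 's::ab_group_add \<Rightarrow> real) \<Rightarrow> (nat \<Rightarrow> nat \<Rightarrow> 's) \<Rightarrow> (nat \<Rightarrow> nat) \<Rightarrow> real mat"
where
  "cov_matrix p c x n = mat (block_end n p) (block_end n p) (\<lambda>(a, b).
     let k = block_index n (a + 1); i = block_offset n (a + 1);
         l = block_index n (b + 1); j = block_offset n (b + 1)
     in c k l (x k i - x l j))"

lemma block_end_mono: "k \<le> l \<Longrightarrow> block_end n k \<le> block_end n l"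
  unfolding block_end_def by (rule sum_mono2) auto

lemma block_end_pred:
  assumes "1 \<le> k" shows "block_end n k = block_end n (k - 1) + n k"
  using assms by (cases k) (simp_all add: block_end_def)

lemma block_index_eq:
  assumes "1 \<le> k" "1 \<le> i" "i \<le> n k"
  shows "block_index n (block_end n (k - 1) + i) = k"
  unfolding block_index_def
proof (rule Least_equality)
  show "block_end n (k - 1) + i \<le> block_end n k"
    using assms block_end_pred[of k n] by simp
next
  fix m assume m: "block_end n (k - 1) + i \<le> block_end n m"
  show "k \<le> m"
  proof (rule ccontr)
    assume "\<not> k \<le> m"
    then have "block_end n m \<le> block_end n (k - 1)" by (intro block_end_mono) simp
    with m assms show False by simp
  qed
qed

lemma block_offset_eq:
  assumes "1 \<le> k" "1 \<le> i" "i \<le> n k"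
  shows "block_offset n (block_end n (k - 1) + i) = i"
  unfolding block_offset_def block_index_eq[where n = n, OF assms] by simp

lemma cov_matrix_entry:
  assumes k: "k \<in> {1..p}" "i \<in> {1..n k}" and l: "l \<in> {1..p}" "j \<in> {1..n l}"
  shows "cov_matrix p c x n $$ (block_end n (k - 1) + i - 1, block_end n (l - 1) + j - 1)
       = c k l (x k i - x l j)"
proof -
  have *: "block_end n (m - 1) + r \<le> block_end n p" if "m \<in> {1..p}" "r \<in> {1..n m}" for m r
    using that block_end_pred[of m n] block_end_mono[of m p n] by simp
  define a where "a = block_end n (k - 1) + i - 1"
  define b where "b = block_end n (l - 1) + j - 1"
  have a: "a + 1 = block_end n (k - 1) + i" and b: "b + 1 = block_end n (l - 1) + j"
    using k l by (simp_all add: a_def b_def)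
  have "a < block_end n p" "b < block_end n p"
    using *[OF k] *[OF l] a b by simp_all
  moreover have "block_index n (a + 1) = k" "block_offset n (a + 1) = i"
    unfolding a using k by (simp_all add: block_index_eq block_offset_eq del: One_nat_def)
  moreover have "block_index n (b + 1) = l" "block_offset n (b + 1) = j"
    unfolding b using l by (simp_all add: block_index_eq block_offset_eq del: One_nat_def)
  ultimately have "cov_matrix p c x n $$ (a, b) = c k l (x k i - x l j)"
    by (simp add: cov_matrix_def Let_def)
  then show ?thesis unfolding a_def b_def .
qed

end

theory Submission
  imports Defs "HOL-Real_Asymp.Real_Asymp"
begin

text \<open>For a vector \<open>v\<close> with blocks \<open>v\<^sub>1, ..., v\<^sub>p\<close> put
  \<open>w\<^sub>k(f) = \<Sum>\<^sub>i v\<^sub>k\<^sub>i exp (- \<i> f \<cdot> x\<^sub>k\<^sub>i)\<close>. By Fourier inversion the quadratic form of the covariance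
  matrix at \<open>v\<close> is the integral over \<open>f\<close> of the quadratic form of the spectral matrix at \<open>w(f)\<close>.
  The integrand is nonnegative, and on a ball of radius \<open>R\<close> it is at least \<open>m |w(f)|\<^sup>2\<close> for some
  \<open>m > 0\<close>, since the spectral matrix is continuous and positive definite. Finally, for \<open>R\<close> large
  depending only on the separation, the integral of \<open>|w\<^sub>k|\<^sup>2\<close> over that ball is at least a constant
  multiple of \<open>|v\<^sub>k|\<^sup>2\<close> (an inequality of Ingham type), because a Gaussian-weighted version of it has
  a diagonally dominant Gram matrix.\<close>

subsection \<open>Integrals over Euclidean space\<close>

text \<open>Fubini: \<open>lborel\<close> is the image under \<open>T\<close> of the product of its
  one-dimensional copies. Both the Gaussian transform and the decay bound are reduced to one
  variable in this way.\<close>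

lemma lborel_integral_prod_Basis:
  fixes g :: "'a::euclidean_space \<Rightarrow> real \<Rightarrow> 'b::{real_normed_field, banach, second_countable_topology}"
  assumes g: "\<And>b. b \<in> Basis \<Longrightarrow> integrable lborel (g b)"
  shows "has_bochner_integral lborel (\<lambda>x::'a. \<Prod>b\<in>Basis. g b (inner x b))
           (\<Prod>b\<in>Basis. LINT u|lborel. g b u)"
proof -
  interpret product_sigma_finite "\<lambda>_::'a. lborel :: real measure"
    by unfold_locales
  define T where "T = (\<lambda>f::'a \<Rightarrow> real. \<Sum>b\<in>Basis. f b *\<^sub>R b)"
  have T: "T \<in> measurable (\<Pi>\<^sub>M b\<in>Basis. lborel) lborel"
    unfolding T_def by measurable
  have meas: "(\<lambda>x::'a. \<Prod>b\<in>Basis. g b (inner x b)) \<in> borel_measurable lborel"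
  proof (rule borel_measurable_prod)
    fix b :: 'a assume "b \<in> Basis"
    then have [measurable]: "g b \<in> borel_measurable borel"
      using borel_measurable_integrable[OF g] by simp
    show "(\<lambda>x. g b (inner x b)) \<in> borel_measurable lborel" by measurable
  qed
  have comp: "(\<lambda>f. \<Prod>b\<in>Basis. g b (inner (T f) b)) = (\<lambda>f. \<Prod>b\<in>Basis. g b (f b))"
    by (intro ext prod.cong) (auto simp: T_def)
  have lb: "lborel = distr (\<Pi>\<^sub>M b\<in>Basis. lborel) borel T"
    unfolding T_def by (rule lborel_eq)
  have "integrable lborel (\<lambda>x::'a. \<Prod>b\<in>Basis. g b (inner x b))"
    using meas T
    by (subst lb) (simp add: integrable_distr_eq comp product_integrable_prod g)
  moreover have "(LINT x|lborel. (\<Prod>b\<in>Basis. g b (inner x b))) = (\<Prod>b\<in>Basis. LINT u|lborel. g b u)"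
    using meas T
    by (subst lb) (simp add: integral_distr comp product_integral_prod g)
  ultimately show ?thesis by (simp add: has_bochner_integral_iff)
qed

text \<open>The substitution \<open>v = sqrt s * u\<close> turns the integral into the
  characteristic function of the standard normal law at \<open>- t / sqrt s\<close>.\<close>

lemma gaussian_fourier_real:
  fixes s t :: real
  assumes s: "s > 0"
  shows "has_bochner_integral lborel
           (\<lambda>u. complex_of_real (exp (- s * u\<^sup>2 / 2)) * exp (- \<i> * complex_of_real (u * t)))
           (complex_of_real (sqrt (2 * pi / s) * exp (- t\<^sup>2 / (2 * s))))"
proof -
  define r where "r = sqrt s"
  have r: "r > 0" "r\<^sup>2 = s" using s by (auto simp: r_def)
  let ?h = "\<lambda>v. std_normal_density v *\<^sub>R iexp ((- t / r) * v)"
  have int: "integrable lborel ?h"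
  proof (rule Bochner_Integration.integrable_bound)
    show "integrable lborel std_normal_density"
      using integrable_std_normal_moment[of 0] by simp
    show "?h \<in> borel_measurable lborel" by measurable
  qed (simp add: norm_mult)
  have "(LINT v|lborel. ?h v) = (CLINT v|std_normal_distribution. iexp ((- t / r) * v))"
    by (subst integral_density) (auto simp: normal_density_nonneg)
  also have "\<dots> = complex_of_real (exp (- (t\<^sup>2 / s) / 2))"
    using fun_cong[OF char_std_normal_distribution, of "- t / r"] r
    unfolding char_def by (simp add: power_divide)
  finally have "has_bochner_integral lborel ?h (complex_of_real (exp (- (t\<^sup>2 / s) / 2)))"
    using int by (simp add: has_bochner_integral_iff)
  then have "complex_of_real (exp (- (t\<^sup>2 / s) / 2)) = r *\<^sub>R (LINT u|lborel. ?h (r * u))"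
    using lborel_integral_real_affine[of r ?h 0] r by (simp add: has_bochner_integral_iff)
  moreover have "integrable lborel (\<lambda>u. ?h (r * u))"
    using lborel_integrable_real_affine[OF int, of r 0] r by simp
  ultimately have "has_bochner_integral lborel (\<lambda>u. ?h (r * u))
      (complex_of_real (exp (- (t\<^sup>2 / s) / 2)) /\<^sub>R r)"
    using r unfolding has_bochner_integral_iff by simp
  from has_bochner_integral_scaleR_right[OF this, of "sqrt (2 * pi)"]
  show ?thesis
  proof (rule has_bochner_integral_cong[THEN iffD1, rotated -1])
    fix u :: real
    have "(r * u)\<^sup>2 = s * u\<^sup>2" "r * u * (t / r) = u * t"
      using r by (auto simp: power_mult_distrib)
    then show "sqrt (2 * pi) *\<^sub>R ?h (r * u) =
        complex_of_real (exp (- s * u\<^sup>2 / 2)) * exp (- \<i> * complex_of_real (u * t))"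
      using r by (simp add: std_normal_density_def scaleR_conv_of_real algebra_simps)
  next
    show "sqrt (2 * pi) *\<^sub>R (complex_of_real (exp (- (t\<^sup>2 / s) / 2)) /\<^sub>R r) =
        complex_of_real (sqrt (2 * pi / s) * exp (- t\<^sup>2 / (2 * s)))"
      using r s by (simp add: scaleR_conv_of_real real_sqrt_divide r_def field_simps)
  qed simp
qed

text \<open>Squared norm and inner product are sums over the basis, so the integrand is a product of
  one-dimensional Gaussians with phases.\<close>

lemma gaussian_fourier:
  fixes y :: "'a::euclidean_space"
  assumes s: "s > 0"
  shows "has_bochner_integral lborel
           (\<lambda>f. complex_of_real (exp (- s * (norm f)\<^sup>2 / 2)) * exp (- \<i> * complex_of_real (inner f y)))
           (complex_of_real (sqrt (2 * pi / s) ^ DIM('a) * exp (- (norm y)\<^sup>2 / (2 * s))))"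
proof -
  let ?g = "\<lambda>b u. complex_of_real (exp (- s * u\<^sup>2 / 2)) * exp (- \<i> * complex_of_real (u * (inner y b)))"
  have nrm: "(norm f)\<^sup>2 = (\<Sum>b\<in>Basis. (inner f b)\<^sup>2)" for f :: 'a
    unfolding power2_norm_eq_inner by (subst euclidean_inner) (simp add: power2_eq_square)
  have "has_bochner_integral lborel (\<lambda>f::'a. \<Prod>b\<in>Basis. ?g b (inner f b))
          (\<Prod>b\<in>Basis. LINT u|lborel. ?g b u)"
    by (rule lborel_integral_prod_Basis) (rule integrable.intros[OF gaussian_fourier_real[OF s]])
  moreover have "(\<Prod>b\<in>Basis. ?g b (inner f b)) =
      complex_of_real (exp (- s * (norm f)\<^sup>2 / 2)) * exp (- \<i> * complex_of_real (inner f y))" for f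
    by (simp add: prod.distrib nrm euclidean_inner[of f y] sum_distrib_left sum_negf sum_divide_distrib
        flip: exp_sum of_real_prod)
  moreover have "(\<Prod>b\<in>(Basis::'a set). LINT u|lborel. ?g b u) =
      complex_of_real (sqrt (2 * pi / s) ^ DIM('a) * exp (- (norm y)\<^sup>2 / (2 * s)))"
    unfolding has_bochner_integral_integral_eq[OF gaussian_fourier_real[OF s]]
    by (simp add: nrm prod.distrib sum_divide_distrib sum_negf flip: exp_sum of_real_prod)
  ultimately show ?thesis by simp
qed

lemma gaussian_integrable:
  assumes s: "s > 0"
  shows "integrable lborel (\<lambda>f::'a::euclidean_space. exp (- s * (norm f)\<^sup>2 / 2))"
proof -
  have "integrable lborel (\<lambda>f::'a. complex_of_real (exp (- s * (norm f)\<^sup>2 / 2)))"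
    using integrable.intros[OF gaussian_fourier[OF s, of "0::'a"]] by simp
  then show ?thesis by (simp only: complex_of_real_integrable_eq)
qed


section \<open>Integrability of the polynomial decay bound\<close>

lemma integrable_one_plus_abs_powr:
  fixes e :: real
  assumes e: "e > 1"
  shows "integrable lborel (\<lambda>u::real. (1 + \<bar>u\<bar>) powr (- e))"
proof -
  let ?h = "\<lambda>x::real. indicator {1..} x *\<^sub>R x powr (- e)"
  have "(\<lambda>x::real. x powr (- e)) integrable_on {1..}"
    using has_integral_powr_to_inf[of "- e" 1] e by (auto simp: integrable_on_def)
  then have "(\<lambda>x::real. x powr (- e)) absolutely_integrable_on {1..}"
    by (intro nonnegative_absolutely_integrable_1) auto
  then have int: "integrable lborel ?h"
    unfolding set_integrable_def by (subst (asm) integrable_completion) auto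
  \<comment> \<open>The two summands serve the two signs of \<open>u\<close>: at every point at
    least one of them equals the target function.\<close>
  have "integrable lborel (\<lambda>u. ?h (1 + 1 * u) + ?h (1 + (- 1) * u))"
    by (intro Bochner_Integration.integrable_add lborel_integrable_real_affine int) auto
  then show ?thesis
    by (rule Bochner_Integration.integrable_bound) (auto simp: indicator_def abs_if)
qed

text \<open>The bound is compared with the product of the functions \<open>(1 + \<bar>u\<bar>) powr - (1 + \<tau> / DIM('a))\<close>
  of the coordinates.\<close>

lemma integrable_infnorm_decay:
  fixes \<tau> :: real
  assumes \<tau>: "\<tau> > 0"
  shows "integrable lborel (\<lambda>x::'a::euclidean_space. 1 / (1 + infnorm x powr (real DIM('a) + \<tau>)))"
proof -
  define D where "D = real DIM('a)"
  have D: "D > 0" by (simp add: D_def)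
  define e where "e = 1 + \<tau> / D"
  have e: "e > 1" and De: "D * e = D + \<tau>" using \<tau> D by (auto simp: e_def field_simps)
  define q where "q = D + \<tau>"
  have q: "q > 0" using \<tau> D by (simp add: q_def)
  have "integrable lborel (\<lambda>x::'a. \<Prod>b\<in>Basis. (1 + \<bar>inner x b\<bar>) powr (- e))"
    using lborel_integral_prod_Basis[of "\<lambda>_ u. (1 + \<bar>u\<bar>) powr (- e)", OF integrable_one_plus_abs_powr[OF e]]
    by (rule integrable.intros)
  then have "integrable lborel (\<lambda>x::'a. 2 powr q * (\<Prod>b\<in>Basis. (1 + \<bar>inner x b\<bar>) powr (- e)))"
    by simp
  then show ?thesis
  proof (rule Bochner_Integration.integrable_bound)
    show "(\<lambda>x::'a. 1 / (1 + infnorm x powr (real DIM('a) + \<tau>))) \<in> borel_measurable lborel"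
      unfolding infnorm_Max by measurable
    show "AE x::'a in lborel. norm (1 / (1 + infnorm x powr (real DIM('a) + \<tau>)))
        \<le> norm (2 powr q * (\<Prod>b\<in>Basis. (1 + \<bar>inner x b\<bar>) powr (- e)))"
    proof (rule AE_I2)
      fix x :: 'a
      define r where "r = infnorm x"
      have r: "r \<ge> 0" by (simp add: r_def infnorm_pos_le)
      have P: "(\<Prod>b\<in>(Basis::'a set). 1 + \<bar>inner x b\<bar>) \<le> (\<Prod>b\<in>(Basis::'a set). 1 + r)"
        by (rule prod_mono) (auto simp: r_def Basis_le_infnorm)
      \<comment> \<open>Compare \<open>1 + r\<close> with \<open>2 * r\<close> if
        \<open>r \<ge> 1\<close> and with 2 otherwise. Halving here is the origin of the factor
        \<open>2 powr q\<close>.\<close>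
      have "((1 + r) / 2) powr q \<le> 1 + r powr q"
      proof (cases "r \<ge> 1")
        case True
        then have "((1 + r) / 2) powr q \<le> r powr q" using q by (intro powr_mono2) auto
        then show ?thesis by simp
      next
        case False
        then have "((1 + r) / 2) powr q \<le> 1 powr q" using q r by (intro powr_mono2) auto
        then show ?thesis by (simp add: add_increasing2)
      qed
      then have "1 / (1 + r powr q) \<le> 1 / (((1 + r) / 2) powr q)"
        using r by (intro divide_left_mono mult_pos_pos) (auto intro: add_pos_nonneg)
      also have "\<dots> = 2 powr q * ((1 + r) ^ DIM('a)) powr (- e)"
      proof -
        have "((1 + r) ^ DIM('a)) powr (- e) = ((1 + r) powr D) powr (- e)"
          using r by (simp add: D_def powr_realpow)
        also have "\<dots> = (1 + r) powr (- q)" by (simp add: powr_powr De q_def)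
        finally show ?thesis using r by (simp add: powr_divide powr_minus field_simps)
      qed
      also have "\<dots> \<le> 2 powr q * (\<Prod>b\<in>(Basis::'a set). 1 + \<bar>inner x b\<bar>) powr (- e)"
        using P e by (intro mult_left_mono powr_mono2') (auto intro!: prod_pos add_pos_nonneg)
      also have "(\<Prod>b\<in>(Basis::'a set). 1 + \<bar>inner x b\<bar>) powr (- e)
          = (\<Prod>b\<in>(Basis::'a set). (1 + \<bar>inner x b\<bar>) powr (- e))"
        by (rule prod_powr_distrib)
      finally show "norm (1 / (1 + infnorm x powr (real DIM('a) + \<tau>)))
          \<le> norm (2 powr q * (\<Prod>b\<in>Basis. (1 + \<bar>inner x b\<bar>) powr (- e)))"
        by (simp add: q_def D_def r_def abs_of_nonneg prod_nonneg add_nonneg_nonneg)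
    qed
  qed
qed

subsection \<open>Exponential sums with separated frequencies\<close>

text \<open>The balls of radius \<open>\<Delta> / 2\<close> about the points are disjoint, so the sum is dominated by the
  integral of a wider Gaussian.\<close>

lemma gaussian_packing:
  fixes \<Delta> :: real
  assumes \<Delta>: "\<Delta> > 0"
  shows "\<exists>K>0. \<forall>S (y :: 'i \<Rightarrow> 'a::euclidean_space) z. finite S \<longrightarrow>
     (\<forall>i\<in>S. \<forall>j\<in>S. i \<noteq> j \<longrightarrow> \<Delta> \<le> norm (y i - y j)) \<longrightarrow>
     (\<Sum>j\<in>S. exp (- (norm (y j - z))\<^sup>2 / 4)) \<le> K"
proof -
  define h where "h f = exp (- (norm f)\<^sup>2 / 8)" for f :: 'a
  have h: "integrable lborel h"
    using gaussian_integrable[of "1/4", where 'a='a] by (simp add: h_def[abs_def])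
  define v where "v = measure lborel (ball (0::'a) (\<Delta> / 2))"
  have v: "v > 0" using \<Delta> by (simp add: v_def content_ball)
  have vball: "measure lborel (ball c (\<Delta> / 2)) = v" for c :: 'a
    using \<Delta> by (simp add: v_def content_ball)
  \<comment> \<open>\<open>E\<close> pays for moving from a centre to any \<open>f\<close> in its
    ball: there \<open>(norm (f - z))\<^sup>2 / 8\<close> is at most
    \<open>(norm (y j - z))\<^sup>2 / 4 + \<Delta>\<^sup>2 / 16\<close>. The summand 1 in
    \<open>K\<close> makes it strictly positive once the integral is known to be
    nonnegative.\<close>
  define E where "E = exp (\<Delta>\<^sup>2 / 16)"
  define K where "K = E * (LINT f|lborel. h f) / v + 1"
  have "(LINT f|lborel. h f) \<ge> 0" by (intro integral_nonneg_AE) (simp add: h_def)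
  then have "K > 0" using v by (simp add: K_def E_def add_nonneg_pos)
  moreover have "(\<Sum>j\<in>S. exp (- (norm (y j - z))\<^sup>2 / 4)) \<le> K"
    if S: "finite S" and sep: "\<forall>i\<in>S. \<forall>j\<in>S. i \<noteq> j \<longrightarrow> \<Delta> \<le> norm (y i - y j)"
    for S and y :: "'i \<Rightarrow> 'a" and z
  proof -
    let ?B = "\<lambda>j. ball (y j) (\<Delta> / 2)"
    let ?e = "\<lambda>j. exp (- (norm (y j - z))\<^sup>2 / 4)"
    have pt: "(\<Sum>j\<in>S. ?e j * indicator (?B j) f) \<le> E * h (f - z)" for f
    proof (cases "\<exists>j\<in>S. f \<in> ?B j")
      case True
      then obtain j where j: "j \<in> S" "f \<in> ?B j" by blast
      have other: "f \<notin> ?B i" if "i \<in> S" "i \<noteq> j" for i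
      proof
        assume "f \<in> ?B i"
        then have "dist (y i) (y j) < \<Delta>" using j(2) dist_triangle2[of "y i" "y j" f] by (simp add: dist_commute)
        then show False using sep that j by (simp add: dist_norm not_less[symmetric])
      qed
      have "(\<Sum>j\<in>S. ?e j * indicator (?B j) f) = ?e j"
        using S j other by (subst sum.remove[OF S j(1)]) (auto intro!: sum.neutral)
      also have "?e j \<le> E * h (f - z)"
      proof -
        have "norm (f - z) \<le> norm (y j - z) + \<Delta> / 2"
          using j(2) norm_triangle_ineq[of "f - y j" "y j - z"] by (simp add: dist_norm norm_minus_commute)
        then have "(norm (f - z))\<^sup>2 \<le> (norm (y j - z) + \<Delta> / 2)\<^sup>2" by (intro power_mono) auto
        also have "\<dots> \<le> 2 * (norm (y j - z))\<^sup>2 + \<Delta>\<^sup>2 / 2"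
          using zero_le_power2[of "norm (y j - z) - \<Delta> / 2"] by (simp add: power2_eq_square algebra_simps)
        finally show ?thesis unfolding E_def h_def exp_add[symmetric] by simp
      qed
      finally show ?thesis .
    next
      case False
      then show ?thesis by (simp add: E_def h_def)
    qed
    have hz: "integrable lborel (\<lambda>f. h (f - z))" "(LINT f|lborel. h (f - z)) = (LINT f|lborel. h f)"
    proof -
      have m: "h \<in> borel_measurable borel" using h by auto
      have d: "distr lborel borel (\<lambda>f. - z + f) = lborel" by (rule lborel_distr_plus)
      show "integrable lborel (\<lambda>f. h (f - z))"
        using h m by (subst (asm) d[symmetric]) (simp add: integrable_distr_eq)
      show "(LINT f|lborel. h (f - z)) = (LINT f|lborel. h f)"
        using m by (subst (2) d[symmetric]) (simp add: integral_distr)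
    qed
    have ind: "integrable lborel (\<lambda>f. ?e j * indicator (?B j) f)" for j
      using emeasure_lborel_ball_finite[of "y j" "\<Delta> / 2"]
      by (intro integrable_mult_right integrable_real_indicator) auto
    \<comment> \<open>Every ball has the same volume \<open>v\<close>, so integrating
      \<open>pt\<close> gives a bound that depends neither on the number of points nor on
      \<open>z\<close>.\<close>
    have "(\<Sum>j\<in>S. ?e j) * v = (LINT f|lborel. (\<Sum>j\<in>S. ?e j * indicator (?B j) f))"
      using ind by (subst Bochner_Integration.integral_sum) (auto simp: vball sum_distrib_right)
    also have "\<dots> \<le> (LINT f|lborel. E * h (f - z))"
      using ind pt hz(1) by (intro integral_mono) auto
    also have "\<dots> = E * (LINT f|lborel. h f)" using hz by simp
    finally show ?thesis using v by (simp add: K_def field_simps)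
  qed
  ultimately show ?thesis by blast
qed

lemma Re_mult_of_real: "Re (z * complex_of_real r) = Re z * r"
  by simp

text \<open>Diagonal dominance. An off-diagonal term is at most \<open>e i j\<close> times the mean
  of the squared moduli of \<open>v i\<close> and \<open>v j\<close>; by symmetry of
  \<open>e\<close> both halves of the mean lead to the same row sums, and these are at most
  \<epsilon>.\<close>

lemma sum_sum_diag_bound:
  fixes e :: "'i \<Rightarrow> 'i \<Rightarrow> real" and v :: "'i \<Rightarrow> complex"
  assumes S: "finite S" and diag: "\<And>i. i \<in> S \<Longrightarrow> e i i = 1"
    and pos: "\<And>i j. 0 \<le> e i j" and sym: "\<And>i j. e i j = e j i"
    and off: "\<And>i. i \<in> S \<Longrightarrow> (\<Sum>j\<in>S - {i}. e i j) \<le> \<epsilon>"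
  shows "\<bar>Re (\<Sum>i\<in>S. \<Sum>j\<in>S. v i * cnj (v j) * complex_of_real (e i j)) - (\<Sum>i\<in>S. (cmod (v i))\<^sup>2)\<bar>
       \<le> \<epsilon> * (\<Sum>i\<in>S. (cmod (v i))\<^sup>2)"
proof -
  let ?o = "\<lambda>i. \<Sum>j\<in>S - {i}. Re (v i * cnj (v j)) * e i j"
  let ?n = "\<lambda>i. (cmod (v i))\<^sup>2"
  have split: "Re (\<Sum>i\<in>S. \<Sum>j\<in>S. v i * cnj (v j) * complex_of_real (e i j)) = (\<Sum>i\<in>S. ?n i) + (\<Sum>i\<in>S. ?o i)"
  proof -
    have "Re (\<Sum>j\<in>S. v i * cnj (v j) * complex_of_real (e i j)) = ?n i + ?o i" if "i \<in> S" for i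
    proof -
      have "v i * cnj (v i) = of_real (?n i)" by (rule complex_norm_square[symmetric])
      then have "Re (v i * cnj (v i)) = ?n i" by (simp only: Re_complex_of_real)
      then have "Re (v i * cnj (v i) * complex_of_real (e i i)) = ?n i"
        using diag[OF that] by simp
      then show ?thesis by (subst sum.remove[OF S that]) (simp only: plus_complex.sel Re_sum Re_mult_of_real)
    qed
    then show ?thesis unfolding Re_sum[of _ S] by (simp add: sum.distrib)
  qed
  \<comment> \<open>With the diagonal set to zero the inner sum runs over all of \<open>S\<close>,
    so the two sums can be swapped.\<close>
  let ?g = "\<lambda>i j. if j = i then 0 else e i j"
  have g: "(\<Sum>j\<in>S - {i}. e i j * f j) = (\<Sum>j\<in>S. ?g i j * f j)" if "i \<in> S" for i and f :: "'i \<Rightarrow> real"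
    using sum.remove[OF S that, of "\<lambda>j. ?g i j * f j"] by (auto intro!: sum.cong)
  have g1: "(\<Sum>j\<in>S. ?g i j) \<le> \<epsilon>" if "i \<in> S" for i
    using g[OF that, of "\<lambda>_. 1"] off[OF that] by simp
  have "\<bar>\<Sum>i\<in>S. ?o i\<bar> \<le> (\<Sum>i\<in>S. \<Sum>j\<in>S. ?g i j * ((?n i + ?n j) / 2))"
  proof (rule order_trans[OF sum_abs], rule sum_mono)
    fix i assume i: "i \<in> S"
    have "\<bar>?o i\<bar> \<le> (\<Sum>j\<in>S - {i}. e i j * ((?n i + ?n j) / 2))"
    proof (rule order_trans[OF sum_abs], rule sum_mono)
      fix j
      have "\<bar>Re (v i * cnj (v j))\<bar> \<le> cmod (v i) * cmod (v j)"
        using abs_Re_le_cmod[of "v i * cnj (v j)"] by (simp add: norm_mult)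
      also have "\<dots> \<le> (?n i + ?n j) / 2"
        using sum_squares_bound[of "cmod (v i)" "cmod (v j)"] by simp
      finally show "\<bar>Re (v i * cnj (v j)) * e i j\<bar> \<le> e i j * ((?n i + ?n j) / 2)"
        using pos[of i j] by (simp only: abs_mult abs_of_nonneg mult.commute[of _ "e i j"] mult_left_mono)
    qed
    then show "\<bar>?o i\<bar> \<le> (\<Sum>j\<in>S. ?g i j * ((?n i + ?n j) / 2))" by (rule ord_le_eq_trans[OF _ g[OF i]])
  qed
  also have "\<dots> = (\<Sum>i\<in>S. \<Sum>j\<in>S. ?g i j * ?n i) / 2 + (\<Sum>i\<in>S. \<Sum>j\<in>S. ?g i j * ?n j) / 2"
    unfolding sum_divide_distrib sum.distrib[symmetric]
    by (intro sum.cong refl) (simp only: distrib_left add_divide_distrib times_divide_eq_right)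
  also have "(\<Sum>i\<in>S. \<Sum>j\<in>S. ?g i j * ?n j) = (\<Sum>i\<in>S. \<Sum>j\<in>S. ?g i j * ?n i)"
  proof (subst sum.swap, intro sum.cong refl)
    show "?g j i * ?n i = ?g i j * ?n i" for i j using sym[of i j] by auto
  qed
  also have "(\<Sum>i\<in>S. \<Sum>j\<in>S. ?g i j * ?n i) / 2 + (\<Sum>i\<in>S. \<Sum>j\<in>S. ?g i j * ?n i) / 2
      = (\<Sum>i\<in>S. (\<Sum>j\<in>S. ?g i j) * ?n i)"
    by (simp only: sum_distrib_right field_sum_of_halves)
  also have "\<dots> \<le> (\<Sum>i\<in>S. \<epsilon> * ?n i)"
    using g1 by (intro sum_mono mult_right_mono) auto
  finally show ?thesis unfolding split by (simp add: sum_distrib_left)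
qed

text \<open>Expanding the square gives a double sum of phases at the differences
  \<open>y i - y j\<close>, each of which is integrated by \<open>gaussian_fourier\<close>.\<close>

lemma gaussian_exponential_sum:
  fixes y :: "'i \<Rightarrow> 'a::euclidean_space"
  assumes S: "finite S" and s: "s > 0"
  shows "has_bochner_integral lborel
     (\<lambda>f. exp (- s * (norm f)\<^sup>2 / 2) * (cmod (\<Sum>i\<in>S. v i * exp (- \<i> * complex_of_real (inner f (y i)))))\<^sup>2)
     (sqrt (2 * pi / s) ^ DIM('a) *
      Re (\<Sum>i\<in>S. \<Sum>j\<in>S. v i * cnj (v j) * complex_of_real (exp (- (norm (y i - y j))\<^sup>2 / (2 * s)))))"
proof -
  let ?c = "sqrt (2 * pi / s) ^ DIM('a)"
  let ?E = "\<lambda>i j. exp (- (norm (y i - y j))\<^sup>2 / (2 * s))"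
  let ?x = "\<lambda>f i. exp (- \<i> * complex_of_real (inner f (y i)))"
  let ?G = "\<lambda>f::'a. complex_of_real (exp (- s * (norm f)\<^sup>2 / 2))"
  have *: "?G f * of_real ((cmod (\<Sum>i\<in>S. v i * ?x f i))\<^sup>2)
      = (\<Sum>i\<in>S. \<Sum>j\<in>S. v i * cnj (v j) * (?G f * exp (- \<i> * complex_of_real (inner f (y i - y j)))))" for f
  proof -
    have "of_real ((cmod (\<Sum>i\<in>S. v i * ?x f i))\<^sup>2) = (\<Sum>i\<in>S. \<Sum>j\<in>S. (v i * ?x f i) * cnj (v j * ?x f j))"
      unfolding complex_norm_square cnj_sum by (rule sum_product)
    also have "\<dots> = (\<Sum>i\<in>S. \<Sum>j\<in>S. v i * cnj (v j) * exp (- \<i> * complex_of_real (inner f (y i - y j))))"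
    proof (intro sum.cong refl)
      fix i j
      have "?x f i * cnj (?x f j) = exp (- \<i> * complex_of_real (inner f (y i - y j)))"
        by (simp add: exp_cnj inner_diff_right algebra_simps flip: exp_add)
      then show "(v i * ?x f i) * cnj (v j * ?x f j) = v i * cnj (v j) * exp (- \<i> * complex_of_real (inner f (y i - y j)))"
        by (simp add: mult_ac)
    qed
    finally show ?thesis by (simp add: sum_distrib_left mult_ac)
  qed
  have "has_bochner_integral lborel (\<lambda>f. ?G f * of_real ((cmod (\<Sum>i\<in>S. v i * ?x f i))\<^sup>2))
     (\<Sum>i\<in>S. \<Sum>j\<in>S. v i * cnj (v j) * of_real (?c * ?E i j))"
    unfolding *
    by (intro has_bochner_integral_sum has_bochner_integral_mult_right gaussian_fourier s)
  also have "(\<Sum>i\<in>S. \<Sum>j\<in>S. v i * cnj (v j) * of_real (?c * ?E i j))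
      = (\<Sum>i\<in>S. \<Sum>j\<in>S. v i * cnj (v j) * of_real (?E i j)) * of_real ?c"
    unfolding sum_distrib_right of_real_mult by (intro sum.cong refl) (simp only: mult_ac)
  finally show ?thesis
    using has_bochner_integral_Re unfolding Re_mult_of_real Re_complex_of_real mult.commute[of ?c]
    by fastforce
qed

text \<open>With \<open>G s f = exp (- s * (norm f)\<^sup>2 / 2)\<close>, the indicator function of \<open>cball 0 R\<close> is at least
  \<open>G s - exp (- s * R\<^sup>2 / 4) * G (s / 2)\<close>. For small \<open>s\<close>, separation makes the Gram matrices of
  both Gaussians diagonally dominant, and then a large \<open>R\<close> makes the second term negligible.\<close>

lemma exponential_sum_lower_bound:
  fixes \<Delta> :: real
  assumes \<Delta>: "\<Delta> > 0"
  shows "\<exists>R \<kappa>. R \<ge> 0 \<and> \<kappa> > 0 \<and> (\<forall>S (y :: 'i \<Rightarrow> 'a::euclidean_space) v. finite S \<longrightarrow>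
     (\<forall>i\<in>S. \<forall>j\<in>S. i \<noteq> j \<longrightarrow> \<Delta> \<le> norm (y i - y j)) \<longrightarrow>
     \<kappa> * (\<Sum>i\<in>S. (cmod (v i))\<^sup>2) \<le> (LINT f|lborel. indicator (cball 0 R) f *
        (cmod (\<Sum>i\<in>S. v i * exp (- \<i> * complex_of_real (inner f (y i)))))\<^sup>2))"
proof -
  obtain K where K: "K > 0" and pack: "\<And>S (y :: 'i \<Rightarrow> 'a) z. finite S \<Longrightarrow>
     (\<forall>i\<in>S. \<forall>j\<in>S. i \<noteq> j \<longrightarrow> \<Delta> \<le> norm (y i - y j)) \<Longrightarrow>
     (\<Sum>j\<in>S. exp (- (norm (y j - z))\<^sup>2 / 4)) \<le> K"
    using gaussian_packing[OF \<Delta>, where 'i='i and 'a='a] by blast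
  have lim: "((\<lambda>s. exp (- \<Delta>\<^sup>2 / (4 * s)) * K) \<longlongrightarrow> 0) (at_right 0)"
    using \<Delta> by real_asymp
  \<comment> \<open>The first condition will keep the off-diagonal row sums below 1/4;
    \<open>s < 1\<close> lets the Gaussian of the packing bound serve as a majorant.\<close>
  have "eventually (\<lambda>s. exp (- \<Delta>\<^sup>2 / (4 * s)) * K < 1/4 \<and> 0 < s \<and> s < 1) (at_right 0)"
    by (intro eventually_conj order_tendstoD(2)[OF lim] eventually_at_right_less
        order_tendstoD(2)[OF tendsto_ident_at]) auto
  then obtain s where s: "exp (- \<Delta>\<^sup>2 / (4 * s)) * K < 1/4" "0 < s" "s < 1"
    by (auto dest!: eventually_happens)
  define c where "c r = sqrt (2 * pi / r) ^ DIM('a)" for r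
  have c: "c r > 0" if "r > 0" for r using that by (simp add: c_def)
  have "((\<lambda>R. exp (- s * R\<^sup>2 / 4) * c (s / 2)) \<longlongrightarrow> 0) at_top"
    using s(2) by real_asymp
  then have "eventually (\<lambda>R. exp (- s * R\<^sup>2 / 4) * c (s / 2) < c s / 4 \<and> R \<ge> 0) at_top"
    using c[OF s(2)] by (intro eventually_conj order_tendstoD eventually_ge_at_top) auto
  then obtain R where R: "exp (- s * R\<^sup>2 / 4) * c (s / 2) < c s / 4" "R \<ge> 0"
    by (auto dest!: eventually_happens)
  define q where "q = exp (- s * R\<^sup>2 / 4)"
  \<comment> \<open>7/16 = 3/4 - (1/4) * (5/4), from the lower bound for \<open>Q s\<close>, the
    choice of \<open>R\<close> and the upper bound for \<open>Q (s / 2)\<close>.\<close>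
  define \<kappa> where "\<kappa> = c s * (7 / 16)"
  have "\<kappa> > 0" using c[OF s(2)] by (simp add: \<kappa>_def)
  moreover have "\<kappa> * (\<Sum>i\<in>S. (cmod (v i))\<^sup>2) \<le> (LINT f|lborel. indicator (cball 0 R) f *
        (cmod (\<Sum>i\<in>S. v i * exp (- \<i> * complex_of_real (inner f (y i)))))\<^sup>2)"
    if S: "finite S" and sep: "\<forall>i\<in>S. \<forall>j\<in>S. i \<noteq> j \<longrightarrow> \<Delta> \<le> norm (y i - y j)"
    for S and y :: "'i \<Rightarrow> 'a" and v
  proof -
    define V where "V = (\<Sum>i\<in>S. (cmod (v i))\<^sup>2)"
    have V: "V \<ge> 0" by (simp add: V_def sum_nonneg)
    let ?W = "\<lambda>f. (cmod (\<Sum>i\<in>S. v i * exp (- \<i> * complex_of_real (inner f (y i)))))\<^sup>2"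
    let ?G = "\<lambda>r f. exp (- r * (norm f)\<^sup>2 / 2) * ?W f"
    define Q where "Q r = Re (\<Sum>i\<in>S. \<Sum>j\<in>S. v i * cnj (v j) * complex_of_real (exp (- (norm (y i - y j))\<^sup>2 / (2 * r))))" for r
    have int: "has_bochner_integral lborel (?G r) (c r * Q r)" if "r > 0" for r
      unfolding c_def Q_def by (rule gaussian_exponential_sum[OF S that])
    have QV: "\<bar>Q r - V\<bar> \<le> 1/4 * V" if r: "0 < r" "r \<le> s" for r
      unfolding V_def Q_def
    proof (rule sum_sum_diag_bound[OF S])
      fix i assume i: "i \<in> S"
      have "(\<Sum>j\<in>S - {i}. exp (- (norm (y i - y j))\<^sup>2 / (2 * r)))
          \<le> (\<Sum>j\<in>S - {i}. exp (- \<Delta>\<^sup>2 / (4 * s)) * exp (- (norm (y j - y i))\<^sup>2 / 4))"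
      proof (rule sum_mono)
        fix j assume j: "j \<in> S - {i}"
        define t where "t = (norm (y j - y i))\<^sup>2"
        have t: "\<Delta>\<^sup>2 \<le> t" unfolding t_def using sep i j \<Delta> by (intro power_mono) auto
        then have t0: "t \<ge> 0" using zero_le_power2[of \<Delta>] by linarith
        have "\<Delta>\<^sup>2 / (4 * s) \<le> t / (4 * r)" using t t0 r by (intro frac_le) auto
        moreover have "t / 4 \<le> t / (4 * r)" using t0 r s by (intro divide_left_mono) auto
        \<comment> \<open>One half of the exponent yields the small factor by separation, the other
          half is kept for the packing bound.\<close>
        moreover have "t / (2 * r) = t / (4 * r) + t / (4 * r)" by simp
        ultimately have "- t / (2 * r) \<le> - \<Delta>\<^sup>2 / (4 * s) + (- t / 4)" by simp
        then show "exp (- (norm (y i - y j))\<^sup>2 / (2 * r))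
            \<le> exp (- \<Delta>\<^sup>2 / (4 * s)) * exp (- (norm (y j - y i))\<^sup>2 / 4)"
          unfolding exp_add[symmetric] t_def by (simp add: norm_minus_commute)
      qed
      also have "\<dots> = exp (- \<Delta>\<^sup>2 / (4 * s)) * (\<Sum>j\<in>S - {i}. exp (- (norm (y j - y i))\<^sup>2 / 4))"
        by (simp only: sum_distrib_left)
      also have "\<dots> \<le> exp (- \<Delta>\<^sup>2 / (4 * s)) * K"
        using S sep by (intro mult_left_mono pack) auto
      finally show "(\<Sum>j\<in>S - {i}. exp (- (norm (y i - y j))\<^sup>2 / (2 * r))) \<le> 1 / 4"
        using s(1) by linarith
    qed (auto simp: norm_minus_commute)
    have pt: "?G s f - q * ?G (s / 2) f \<le> indicator (cball 0 R) f * ?W f" for f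
    proof (cases "norm f \<le> R")
      case True
      have "exp (- s * (norm f)\<^sup>2 / 2) * ?W f \<le> 1 * ?W f"
        using s(2) by (intro mult_right_mono) auto
      moreover have "0 \<le> q * ?G (s / 2) f" by (simp add: q_def)
      ultimately show ?thesis using True by simp
    next
      case False
      then have "R\<^sup>2 \<le> (norm f)\<^sup>2" using R(2) by (intro power_mono) auto
      then have "s * R\<^sup>2 \<le> s * (norm f)\<^sup>2" using s(2) by simp
      \<comment> \<open>Outside the ball, half of the exponent is already at least
        \<open>s * R\<^sup>2 / 4\<close>, which accounts for \<open>q\<close>.\<close>
      then have le: "exp (- s * (norm f)\<^sup>2 / 2) \<le> q * exp (- (s / 2) * (norm f)\<^sup>2 / 2)"
        unfolding q_def exp_add[symmetric] by simp
      have "?G s f \<le> q * ?G (s / 2) f"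
        using mult_right_mono[OF le, of "?W f"] by (simp add: mult.assoc)
      then show ?thesis using False by simp
    qed
    have "\<kappa> * V \<le> c s * Q s - q * (c (s / 2) * Q (s / 2))"
    proof -
      have "3/4 * V \<le> Q s" "Q (s / 2) \<le> 5/4 * V" using QV[of s] QV[of "s/2"] s(2) by linarith+
      then have "c s * (3/4 * V) \<le> c s * Q s" "q * c (s / 2) * Q (s / 2) \<le> q * c (s / 2) * (5/4 * V)"
        using c s(2) by (auto intro!: mult_left_mono simp: q_def less_imp_le)
      moreover have "q * c (s / 2) * (5/4 * V) \<le> c s / 4 * (5/4 * V)"
        using R(1) V by (intro mult_right_mono) (auto simp: q_def)
      ultimately show ?thesis by (simp add: \<kappa>_def algebra_simps)
    qed
    also have "\<dots> = (LINT f|lborel. ?G s f - q * ?G (s / 2) f)"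
      using int[of s] int[of "s / 2"] s(2)
      by (subst Bochner_Integration.integral_diff) (auto simp: has_bochner_integral_iff)
    also have "\<dots> \<le> (LINT f|lborel. indicator (cball 0 R) f * ?W f)"
    proof (rule integral_mono[OF _ _ pt])
      show "integrable lborel (\<lambda>f. ?G s f - q * ?G (s / 2) f)"
        using int[of s] int[of "s / 2"] s(2)
        by (intro Bochner_Integration.integrable_diff) (auto simp: has_bochner_integral_iff)
      have "integrable lborel (\<lambda>f. indicator (cball 0 R) f *\<^sub>R ?W f)"
        by (intro borel_integrable_compact continuous_intros) auto
      then show "integrable lborel (\<lambda>f. indicator (cball 0 R) f * ?W f)" by simp
    qed
    finally show ?thesis by (simp add: V_def)
  qed
  ultimately show ?thesis using R(2) by blast
qed

subsection \<open>Families of Hermitian matrices\<close>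

text \<open>Vectors and matrices are plain functions here, so that compactness and continuity come
  from the product topology.\<close>

definition sesq :: "nat \<Rightarrow> (nat \<Rightarrow> nat \<Rightarrow> complex) \<Rightarrow> (nat \<Rightarrow> complex) \<Rightarrow> complex" where
  "sesq p B w = (\<Sum>k<p. \<Sum>l<p. cnj (w k) * B k l * w l)"

lemma sesq_eq: "sesq p B w = (\<Sum>k<p. cnj (w k) * (\<Sum>l<p. B k l * w l))"
  unfolding sesq_def by (simp add: sum_distrib_left mult.assoc)

text \<open>A zero of a nonnegative form is a minimum, so the first variation vanishes there. In the
  direction \<open>u\<close> given by the matrix applied to \<open>w0\<close>, that variation is
  twice the squared norm of \<open>u\<close>.\<close>

lemma psd_kernel:
  assumes herm: "\<And>k l. k < p \<Longrightarrow> l < p \<Longrightarrow> B l k = cnj (B k l)"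
    and psd: "\<And>w. 0 \<le> Re (sesq p B w)"
    and w0: "Re (sesq p B w0) = 0"
    and k: "k < p"
  shows "(\<Sum>l<p. B k l * w0 l) = 0"
proof -
  define u where "u k = (\<Sum>l<p. B k l * w0 l)" for k
  define N where "N = (\<Sum>k<p. (cmod (u k))\<^sup>2)"
  define a where "a = Re (sesq p B u)"
  have cross1: "(\<Sum>k<p. \<Sum>l<p. cnj (u k) * B k l * w0 l) = of_real N"
  proof -
    have "(\<Sum>k<p. \<Sum>l<p. cnj (u k) * B k l * w0 l) = (\<Sum>k<p. cnj (u k) * u k)"
      by (simp add: u_def sum_distrib_left mult.assoc)
    then show ?thesis by (simp add: N_def complex_norm_square mult.commute del: of_real_power)
  qed
  have cross2: "(\<Sum>k<p. \<Sum>l<p. cnj (w0 k) * B k l * u l) = of_real N"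
  proof -
    have "(\<Sum>k<p. \<Sum>l<p. cnj (w0 k) * B k l * u l)
        = (\<Sum>k<p. \<Sum>l<p. cnj (cnj (u l) * B l k * w0 k))"
    proof (intro sum.cong refl)
      fix k l assume "k \<in> {..<p}" "l \<in> {..<p}"
      then have "B k l = cnj (B l k)" using herm[of l k] by simp
      then show "cnj (w0 k) * B k l * u l = cnj (cnj (u l) * B l k * w0 k)"
        by (simp only: complex_cnj_mult complex_cnj_cnj mult_ac)
    qed
    also have "\<dots> = cnj (\<Sum>l<p. \<Sum>k<p. cnj (u l) * B l k * w0 k)"
      by (subst sum.swap) simp
    finally show ?thesis unfolding cross1 by simp
  qed
  have expand: "Re (sesq p B (\<lambda>k. w0 k + of_real t * u k)) = 2 * t * N + t\<^sup>2 * a" for t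
  proof -
    have "sesq p B (\<lambda>k. w0 k + of_real t * u k) = sesq p B w0
       + of_real t * (\<Sum>k<p. \<Sum>l<p. cnj (u k) * B k l * w0 l)
       + of_real t * (\<Sum>k<p. \<Sum>l<p. cnj (w0 k) * B k l * u l) + of_real (t\<^sup>2) * sesq p B u"
      unfolding sesq_def sum_distrib_left sum.distrib[symmetric]
      by (intro sum.cong refl) (simp add: algebra_simps power2_eq_square)
    then show ?thesis unfolding cross1 cross2 using w0 by (simp add: a_def)
  qed
  have "N \<ge> 0" by (simp add: N_def sum_nonneg)
  have "N \<le> 0"
  proof (rule ccontr)
    assume "\<not> N \<le> 0"
    then have N: "N > 0" by simp
    \<comment> \<open>Negative, and small enough that the quadratic term cannot outweigh the linear
      one: \<open>2 * N + t * a\<close> stays at least \<open>N\<close>.\<close>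
    define t where "t = - N / (\<bar>a\<bar> + 1)"
    have "t * (2 * N + t * a) \<ge> 0"
      using psd[of "\<lambda>k. w0 k + of_real t * u k"] unfolding expand
      by (simp add: power2_eq_square algebra_simps)
    moreover have "t < 0" using N by (simp add: t_def divide_pos_pos)
    moreover have "t * a \<ge> - N"
    proof -
      have "\<bar>t * a\<bar> = N * (\<bar>a\<bar> / (\<bar>a\<bar> + 1))" using N by (simp add: t_def abs_mult)
      also have "\<dots> \<le> N * 1" using N by (intro mult_left_mono) auto
      finally show ?thesis by linarith
    qed
    ultimately show False using N by (simp add: zero_le_mult_iff)
  qed
  with \<open>N \<ge> 0\<close> have "N = 0" by simp
  then have "(cmod (u k))\<^sup>2 = 0"
    unfolding N_def using k by (subst (asm) sum_nonneg_eq_0_iff) auto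
  then show ?thesis by (simp add: u_def)
qed

text \<open>Forcing the coordinates from \<open>p\<close> on to vanish is what makes this set
  compact among all functions on the naturals.\<close>

definition csphere :: "nat \<Rightarrow> (nat \<Rightarrow> complex) set" where
  "csphere p = {w. (\<forall>k\<ge>p. w k = 0) \<and> (\<Sum>k<p. (cmod (w k))\<^sup>2) = 1}"

text \<open>A closed subset of a product of unit discs, which is compact by Tychonoff's
  theorem.\<close>

lemma compact_csphere: "compact (csphere p)"
proof -
  have "compactin euclidean (PiE UNIV (\<lambda>k::nat. cball (0::complex) 1))"
    unfolding euclidean_product_topology[symmetric] compactin_PiE by simp
  then have c: "compact (PiE UNIV (\<lambda>k::nat. cball (0::complex) 1))" by simp
  have 1: "closed {w::nat\<Rightarrow>complex. (\<Sum>k<p. (cmod (w k))\<^sup>2) = 1}"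
    by (intro closed_Collect_eq continuous_intros continuous_on_product_coordinates)
  have 2: "closed {w::nat\<Rightarrow>complex. \<forall>k. k \<ge> p \<longrightarrow> w k = 0}"
    by (intro closed_Collect_all closed_Collect_imp open_Collect_const closed_Collect_eq
        continuous_on_const continuous_on_product_coordinates)
  have sub: "csphere p \<subseteq> PiE UNIV (\<lambda>k. cball 0 1)"
  proof
    fix w assume w: "w \<in> csphere p"
    have "cmod (w k) \<le> 1" for k
    proof (cases "k < p")
      case True
      then have "(cmod (w k))\<^sup>2 \<le> (\<Sum>k<p. (cmod (w k))\<^sup>2)"
        by (intro member_le_sum) auto
      then show ?thesis using w by (simp add: csphere_def power_le_one_iff)
    qed (use w in \<open>auto simp: csphere_def\<close>)
    then show "w \<in> PiE UNIV (\<lambda>k. cball 0 1)" by auto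
  qed
  have "csphere p = PiE UNIV (\<lambda>k. cball 0 1) \<inter> ({w. \<forall>k. k \<ge> p \<longrightarrow> w k = 0} \<inter> {w. (\<Sum>k<p. (cmod (w k))\<^sup>2) = 1})"
    using sub by (auto simp: csphere_def)
  then show ?thesis using compact_Int_closed[OF c closed_Int[OF 2 1]] by simp
qed

lemma sesq_lower_bound_of_csphere:
  assumes low: "\<And>w. w \<in> csphere p \<Longrightarrow> m \<le> Re (sesq p B w)"
  shows "m * (\<Sum>k<p. (cmod (w k))\<^sup>2) \<le> Re (sesq p B w)"
proof (cases "(\<Sum>k<p. (cmod (w k))\<^sup>2) = 0")
  case True
  then have "\<And>k. k < p \<Longrightarrow> w k = 0" by (subst (asm) sum_nonneg_eq_0_iff) auto
  then have "sesq p B w = 0" by (simp add: sesq_def)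
  then show ?thesis using True by simp
next
  case False
  define s where "s = sqrt (\<Sum>k<p. (cmod (w k))\<^sup>2)"
  have s2: "s\<^sup>2 = (\<Sum>k<p. (cmod (w k))\<^sup>2)" by (simp add: s_def sum_nonneg)
  have s: "s \<noteq> 0" using False s2 by auto
  \<comment> \<open>Cutting off at \<open>p\<close> puts the normalised vector into
    \<open>csphere p\<close> and leaves the form unchanged up to scaling.\<close>
  define u where "u k = (if k < p then w k / of_real s else 0)" for k
  have "(\<Sum>k<p. (cmod (u k))\<^sup>2) = (\<Sum>k<p. (cmod (w k))\<^sup>2) / s\<^sup>2"
    by (simp add: u_def norm_divide power_divide sum_divide_distrib)
  then have "u \<in> csphere p" using s by (simp add: csphere_def s2[symmetric] u_def)
  then have "m \<le> Re (sesq p B u)" by (rule low)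
  also have "sesq p B u = sesq p B w / of_real (s\<^sup>2)"
    unfolding sesq_def sum_divide_distrib
    by (intro sum.cong refl) (simp add: u_def power2_eq_square)
  also have "Re \<dots> = Re (sesq p B w) / s\<^sup>2" by (rule Re_divide_of_real)
  finally show ?thesis using s by (simp add: s2[symmetric] field_simps)
qed

text \<open>A minimiser of the Rayleigh quotient over all of \<open>K\<close> and all unit vectors is an
  eigenvector at its own frequency, so the minimum is positive; no diagonalisation is needed.\<close>

lemma hermitian_uniform_lower_bound:
  fixes B :: "'f::topological_space \<Rightarrow> nat \<Rightarrow> nat \<Rightarrow> complex"
  assumes p: "p \<ge> 1" and K: "compact K" "K \<noteq> {}"
    and cont: "\<And>k l. k < p \<Longrightarrow> l < p \<Longrightarrow> continuous_on K (\<lambda>f. B f k l)"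
    and herm: "\<And>f k l. f \<in> K \<Longrightarrow> k < p \<Longrightarrow> l < p \<Longrightarrow> B f l k = cnj (B f k l)"
    and eig: "\<And>f m w. f \<in> K \<Longrightarrow> \<exists>k<p. w k \<noteq> 0 \<Longrightarrow>
        (\<And>k. k < p \<Longrightarrow> (\<Sum>l<p. B f k l * w l) = complex_of_real m * w k) \<Longrightarrow> m > 0"
  shows "\<exists>m>0. \<forall>f\<in>K. \<forall>w. m * (\<Sum>k<p. (cmod (w k))\<^sup>2) \<le> Re (sesq p (B f) w)"
proof -
  have "(\<lambda>k. if k = 0 then 1 else 0) \<in> csphere p"
    using p by (auto simp: csphere_def if_distrib[of cmod] if_distrib[of "\<lambda>x. x\<^sup>2"] cong: if_cong)
  then have ne: "K \<times> csphere p \<noteq> {}" using K by auto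
  have c1: "continuous_on (K \<times> csphere p) (\<lambda>z. B (fst z) k l)" if "k < p" "l < p" for k l
    using continuous_on_compose2[OF cont[OF that] continuous_on_fst[OF continuous_on_id], of "K \<times> csphere p"]
    by auto
  have c2: "continuous_on (K \<times> csphere p) (\<lambda>z. snd z k)" for k
    using continuous_on_compose2[OF continuous_on_product_coordinates[of k]
        continuous_on_snd[OF continuous_on_id], of "K \<times> csphere p"]
    by simp
  have "continuous_on (K \<times> csphere p) (\<lambda>z. Re (sesq p (B (fst z)) (snd z)))"
    unfolding sesq_def by (intro continuous_intros c1 c2) auto
  then obtain z where z: "z \<in> K \<times> csphere p"
    and zmin: "\<And>z'. z' \<in> K \<times> csphere p \<Longrightarrow> Re (sesq p (B (fst z)) (snd z)) \<le> Re (sesq p (B (fst z')) (snd z'))"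
    using continuous_attains_inf[OF compact_Times[OF K(1) compact_csphere] ne] by blast
  obtain f0 w0 where zz: "z = (f0, w0)" by force
  have f0: "f0 \<in> K" and w0: "w0 \<in> csphere p" using z zz by auto
  define m where "m = Re (sesq p (B f0) w0)"
  have low: "m * (\<Sum>k<p. (cmod (w k))\<^sup>2) \<le> Re (sesq p (B f) w)" if "f \<in> K" for f w
  proof (rule sesq_lower_bound_of_csphere)
    fix w assume "w \<in> csphere p"
    then show "m \<le> Re (sesq p (B f) w)" using zmin[of "(f, w)"] that by (simp add: m_def zz)
  qed
  \<comment> \<open>Subtracting the minimum \<open>m\<close> times the identity leaves a nonnegative
    form that vanishes at \<open>w0\<close>; \<open>psd_kernel\<close> then says that
    \<open>w0\<close> is an eigenvector for \<open>m\<close>.\<close>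
  define B' where "B' k l = B f0 k l - (if k = l then complex_of_real m else 0)" for k l
  have B': "(\<Sum>l<p. B' k l * w l) = (\<Sum>l<p. B f0 k l * w l) - of_real m * w k" if "k < p" for k w
  proof -
    have "(\<Sum>l<p. B' k l * w l)
        = (\<Sum>l<p. B f0 k l * w l) - (\<Sum>l<p. if k = l then of_real m * w l else 0)"
      by (simp add: B'_def left_diff_distrib sum_subtractf if_distrib[of "\<lambda>x. x * _"] cong: if_cong)
    then show ?thesis using that by simp
  qed
  have sesqB': "Re (sesq p B' w) = Re (sesq p (B f0) w) - m * (\<Sum>k<p. (cmod (w k))\<^sup>2)" for w
  proof -
    have "sesq p B' w = (\<Sum>k<p. cnj (w k) * ((\<Sum>l<p. B f0 k l * w l) - of_real m * w k))"
      unfolding sesq_eq by (simp add: B')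
    also have "\<dots> = sesq p (B f0) w - of_real m * (\<Sum>k<p. cnj (w k) * w k)"
      unfolding sesq_eq by (simp add: right_diff_distrib sum_subtractf sum_distrib_left mult_ac)
    also have "(\<Sum>k<p. cnj (w k) * w k) = of_real (\<Sum>k<p. (cmod (w k))\<^sup>2)"
      by (simp add: complex_norm_square mult.commute del: of_real_power)
    finally show ?thesis by simp
  qed
  have "(\<Sum>l<p. B' k l * w0 l) = 0" if "k < p" for k
  proof (rule psd_kernel[OF _ _ _ that])
    show "B' l k = cnj (B' k l)" if "k < p" "l < p" for k l
      using herm[OF f0 that] by (auto simp: B'_def)
    show "0 \<le> Re (sesq p B' w)" for w using low[OF f0, of w] by (simp add: sesqB')
    show "Re (sesq p B' w0) = 0" using w0 by (simp add: sesqB' csphere_def m_def)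
  qed
  then have "(\<Sum>l<p. B f0 k l * w0 l) = of_real m * w0 k" if "k < p" for k
    using B'[OF that, of w0] that by simp
  moreover have "\<exists>k<p. w0 k \<noteq> 0"
  proof (rule ccontr)
    assume "\<not> (\<exists>k<p. w0 k \<noteq> 0)"
    then have "(\<Sum>k<p. (cmod (w0 k))\<^sup>2) = 0" by simp
    then show False using w0 by (simp add: csphere_def)
  qed
  ultimately have "m > 0" using eig[OF f0] by blast
  then show ?thesis using low by blast
qed

subsection \<open>Matrix covariance functions\<close>

text \<open>Dominated convergence along sequences: with \<open>a\<close> purely imaginary the phase
  has modulus 1, so \<open>norm (h f)\<close> dominates. The case \<open>- \<i>\<close> is used for
  the transform, the case \<open>\<i>\<close> for its inversion.\<close>

lemma continuous_on_lborel_integral_phase: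
  fixes h :: "'a::euclidean_space \<Rightarrow> complex"
  assumes h: "integrable lborel h" and a: "Re a = 0"
  shows "continuous_on UNIV (\<lambda>y. LINT f|lborel. h f * exp (a * complex_of_real (inner f y)))"
proof -
  have m[measurable]: "h \<in> borel_measurable borel" using h by auto
  have "isCont (\<lambda>y. LINT f|lborel. h f * exp (a * complex_of_real (inner f y))) y" for y
    unfolding continuous_at_sequentially comp_def
  proof (intro allI impI)
    fix x assume x: "x \<longlonglongrightarrow> y"
    show "(\<lambda>n. LINT f|lborel. h f * exp (a * complex_of_real (inner f (x n))))
        \<longlonglongrightarrow> (LINT f|lborel. h f * exp (a * complex_of_real (inner f y)))"
    proof (rule integral_dominated_convergence)
      show "integrable lborel (\<lambda>f. norm (h f))" using h by (rule integrable_norm)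
      show "AE f in lborel. (\<lambda>n. h f * exp (a * complex_of_real (inner f (x n))))
          \<longlonglongrightarrow> h f * exp (a * complex_of_real (inner f y))"
        by (intro AE_I2 tendsto_intros x)
    qed (auto simp: norm_mult a)
  qed
  then show ?thesis by (simp add: continuous_on_eq_continuous_at)
qed

lemma continuous_on_fourier:
  assumes "integrable lborel g"
  shows "continuous_on UNIV (fourier g)"
proof -
  have "integrable lborel (\<lambda>x. complex_of_real (g x))" using assms by simp
  from continuous_on_lborel_integral_phase[OF this, of "- \<i>"]
  have "continuous_on UNIV (\<lambda>f. LINT x|lborel. complex_of_real (g x) * exp (- \<i> * complex_of_real (inner f x)))"
    by (simp only: inner_commute) simp
  then show ?thesis unfolding fourier_def[abs_def] by (intro continuous_on_mult continuous_on_const)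
qed

lemma lborel_distr_uminus_euclidean: "distr lborel borel uminus = (lborel :: 'a::euclidean_space measure)"
  using lborel_affine[of "- 1" "0::'a"] by (simp add: density_1)

text \<open>Substituting \<open>- x\<close> for \<open>x\<close> flips the sign of the phase, which
  for real \<open>g\<close> is conjugation. Together with \<open>covariance_function_reflect\<close>
  this makes the spectral matrix Hermitian.\<close>

lemma fourier_reflect:
  assumes [measurable]: "g \<in> borel_measurable borel"
  shows "fourier (\<lambda>x. g (- x)) f = cnj (fourier g f)"
proof -
  let ?h = "\<lambda>x. complex_of_real (g x) * exp (\<i> * complex_of_real (inner f x))"
  have "(LINT x|lborel. complex_of_real (g (- x)) * exp (- \<i> * complex_of_real (inner f x)))
      = (LINT x|lborel. ?h (- x))" by simp
  also have "\<dots> = (LINT x|lborel. ?h x)"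
    by (subst (2) lborel_distr_uminus_euclidean[symmetric], subst integral_distr) auto
  also have "\<dots> = (LINT x|lborel. cnj (complex_of_real (g x) * exp (- \<i> * complex_of_real (inner f x))))"
    by (simp add: exp_cnj)
  also have "\<dots> = cnj (LINT x|lborel. complex_of_real (g x) * exp (- \<i> * complex_of_real (inner f x)))"
    by (rule Bochner_Integration.integral_cnj)
  finally show ?thesis by (simp add: fourier_def)
qed

text \<open>Covariance is symmetric in its two variables; compare the sites 0 and
  \<open>h\<close>.\<close>

lemma covariance_function_reflect:
  assumes "is_matrix_covariance_function M p Z c" "k \<in> {1..p}" "l \<in> {1..p}"
  shows "c l k h = c k l (- h)"
proof -
  have "covariance M (Z k 0) (Z l h) = covariance M (Z l h) (Z k 0)"
    by (simp add: covariance_def mult.commute)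
  moreover have "covariance M (Z k 0) (Z l h) = c k l (0 - h)" "covariance M (Z l h) (Z k 0) = c l k (h - 0)"
    using assms unfolding is_matrix_covariance_function_def by blast+
  ultimately show ?thesis by simp
qed

text \<open>Decay alone does not give measurability of \<open>g\<close>; the inversion formula makes \<open>g\<close> continuous.\<close>

lemma integrable_of_fourier_inversion:
  fixes g :: "real^'d \<Rightarrow> real"
  assumes \<tau>: "\<tau> > 0" and decay: "\<And>y. \<bar>g y\<bar> \<le> A / (1 + infnorm y powr (real CARD('d) + \<tau>))"
    and inv: "\<And>y. has_bochner_integral lborel
        (\<lambda>f. fourier g f * exp (\<i> * complex_of_real (inner f y))) (complex_of_real (g y))"
  shows "integrable lborel g"
proof -
  \<comment> \<open>At the origin the phase is 1, so the inversion hypothesis contains integrability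
    of the transform.\<close>
  have "integrable lborel (fourier g)" using integrable.intros[OF inv[of 0]] by simp
  from continuous_on_lborel_integral_phase[OF this, of \<i>]
  have "continuous_on UNIV (\<lambda>y. complex_of_real (g y))"
    by (simp add: has_bochner_integral_integral_eq[OF inv])
  from continuous_on_Re[OF this] have cont: "continuous_on UNIV g" by simp
  have "integrable lborel (\<lambda>y::real^'d. A * (1 / (1 + infnorm y powr (real DIM(real^'d) + \<tau>))))"
    by (intro integrable_mult_right integrable_infnorm_decay \<tau>)
  then show ?thesis
  proof (rule Bochner_Integration.integrable_bound)
    show "g \<in> borel_measurable lborel" using borel_measurable_continuous_onI[OF cont] by simp
    show "AE y in lborel. norm (g y) \<le> norm (A * (1 / (1 + infnorm y powr (real DIM(real^'d) + \<tau>))))"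
    proof (rule AE_I2)
      fix y :: "real^'d"
      show "norm (g y) \<le> norm (A * (1 / (1 + infnorm y powr (real DIM(real^'d) + \<tau>))))"
        using order_trans[OF decay[of y] abs_ge_self] by simp
    qed
  qed
qed

text \<open>Observations are indexed by one finite set, and the fibres of \<kappa> are the
  components, so no block numbering enters. The bound \<open>expsum\<close> is applied to each fibre
  separately; points of different components may therefore coincide.\<close>

lemma spectral_quadratic_form_bound:
  fixes c :: "nat \<Rightarrow> nat \<Rightarrow> 'a::euclidean_space \<Rightarrow> real" and ch :: "'a \<Rightarrow> nat \<Rightarrow> nat \<Rightarrow> complex"
    and y :: "'i \<Rightarrow> 'a" and v :: "'i \<Rightarrow> complex"
  assumes S: "finite S" and \<kappa>: "\<And>a. a \<in> S \<Longrightarrow> \<kappa> a < p"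
    and inv: "\<And>k l y. k < p \<Longrightarrow> l < p \<Longrightarrow> has_bochner_integral lborel
        (\<lambda>f. ch f k l * exp (\<i> * complex_of_real (inner f y))) (complex_of_real (c k l y))"
    and psd: "\<And>f w. 0 \<le> Re (sesq p (ch f) w)"
    and m: "m \<ge> 0" and low: "\<And>f w. f \<in> cball 0 R \<Longrightarrow> m * (\<Sum>k<p. (cmod (w k))\<^sup>2) \<le> Re (sesq p (ch f) w)"
    and expsum: "\<And>k. k < p \<Longrightarrow> \<gamma> * (\<Sum>a | a \<in> S \<and> \<kappa> a = k. (cmod (v a))\<^sup>2)
        \<le> (LINT f|lborel. indicator (cball 0 R) f *
           (cmod (\<Sum>a | a \<in> S \<and> \<kappa> a = k. v a * exp (- \<i> * complex_of_real (inner f (y a)))))\<^sup>2)"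
  shows "m * \<gamma> * (\<Sum>a\<in>S. (cmod (v a))\<^sup>2)
    \<le> Re (\<Sum>a\<in>S. \<Sum>b\<in>S. cnj (v a) * v b * complex_of_real (c (\<kappa> a) (\<kappa> b) (y a - y b)))"
proof -
  let ?x = "\<lambda>f a. exp (- \<i> * complex_of_real (inner f (y a)))"
  define w where "w f k = (\<Sum>a | a \<in> S \<and> \<kappa> a = k. v a * ?x f a)" for f k
  have fib: "(\<Sum>a\<in>S. F a) = (\<Sum>k<p. \<Sum>a | a \<in> S \<and> \<kappa> a = k. F a)" for F :: "'i \<Rightarrow> 'b::comm_monoid_add"
    by (rule sum.group[symmetric]) (use S \<kappa> in auto)
  have form: "sesq p (ch f) (w f) = (\<Sum>a\<in>S. \<Sum>b\<in>S. cnj (v a) * v b *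
      (ch f (\<kappa> a) (\<kappa> b) * exp (\<i> * complex_of_real (inner f (y a - y b)))))" for f
  proof -
    have "sesq p (ch f) (w f) = (\<Sum>k<p. \<Sum>l<p. \<Sum>a | a \<in> S \<and> \<kappa> a = k. \<Sum>b | b \<in> S \<and> \<kappa> b = l.
        cnj (v a * ?x f a) * ch f (\<kappa> a) (\<kappa> b) * (v b * ?x f b))"
    proof (unfold sesq_def, intro sum.cong refl)
      fix k l
      have "cnj (w f k) * ch f k l * w f l = (\<Sum>a | a \<in> S \<and> \<kappa> a = k. \<Sum>b | b \<in> S \<and> \<kappa> b = l.
        cnj (v a * ?x f a) * ch f k l * (v b * ?x f b))"
        unfolding w_def cnj_sum sum_distrib_right by (simp only: sum_distrib_left)
      also have "\<dots> = (\<Sum>a | a \<in> S \<and> \<kappa> a = k. \<Sum>b | b \<in> S \<and> \<kappa> b = l.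
        cnj (v a * ?x f a) * ch f (\<kappa> a) (\<kappa> b) * (v b * ?x f b))"
        by (intro sum.cong refl) auto
      finally show "cnj (w f k) * ch f k l * w f l = \<dots>" .
    qed
    also have "\<dots> = (\<Sum>k<p. \<Sum>a | a \<in> S \<and> \<kappa> a = k. \<Sum>l<p. \<Sum>b | b \<in> S \<and> \<kappa> b = l.
        cnj (v a * ?x f a) * ch f (\<kappa> a) (\<kappa> b) * (v b * ?x f b))"
      by (intro sum.cong refl) (rule sum.swap)
    also have "\<dots> = (\<Sum>a\<in>S. \<Sum>b\<in>S. cnj (v a * ?x f a) * ch f (\<kappa> a) (\<kappa> b) * (v b * ?x f b))"
      by (simp only: fib)
    also have "\<dots> = (\<Sum>a\<in>S. \<Sum>b\<in>S. cnj (v a) * v b *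
      (ch f (\<kappa> a) (\<kappa> b) * exp (\<i> * complex_of_real (inner f (y a - y b)))))"
    proof (intro sum.cong refl)
      fix a b
      have "cnj (?x f a) * ?x f b = exp (\<i> * complex_of_real (inner f (y a - y b)))"
        by (simp add: exp_cnj inner_diff_right algebra_simps flip: exp_add)
      then show "cnj (v a * ?x f a) * ch f (\<kappa> a) (\<kappa> b) * (v b * ?x f b) = cnj (v a) * v b *
        (ch f (\<kappa> a) (\<kappa> b) * exp (\<i> * complex_of_real (inner f (y a - y b))))"
        by (simp add: mult_ac)
    qed
    finally show ?thesis .
  qed
  have int: "has_bochner_integral lborel (\<lambda>f. Re (sesq p (ch f) (w f)))
     (Re (\<Sum>a\<in>S. \<Sum>b\<in>S. cnj (v a) * v b * complex_of_real (c (\<kappa> a) (\<kappa> b) (y a - y b))))"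
    unfolding form
    by (intro has_bochner_integral_Re has_bochner_integral_sum has_bochner_integral_mult_right inv \<kappa>)
  let ?I = "\<lambda>f k. indicator (cball 0 R) f * (cmod (w f k))\<^sup>2"
  have I: "integrable lborel (\<lambda>f. ?I f k)" for k
  proof -
    have "integrable lborel (\<lambda>f. indicator (cball 0 R) f *\<^sub>R (cmod (w f k))\<^sup>2)"
      unfolding w_def by (intro borel_integrable_compact continuous_intros) auto
    then show ?thesis by simp
  qed
  have "m * \<gamma> * (\<Sum>a\<in>S. (cmod (v a))\<^sup>2) = m * (\<Sum>k<p. \<gamma> * (\<Sum>a | a \<in> S \<and> \<kappa> a = k. (cmod (v a))\<^sup>2))"
    by (subst fib) (simp add: sum_distrib_left mult.assoc)
  also have "\<dots> \<le> m * (\<Sum>k<p. LINT f|lborel. ?I f k)"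
    unfolding w_def using m expsum by (intro mult_left_mono sum_mono) auto
  also have "\<dots> = (LINT f|lborel. m * (\<Sum>k<p. ?I f k))"
    by (simp only: integral_mult_right_zero Bochner_Integration.integral_sum I)
  also have "\<dots> \<le> (LINT f|lborel. Re (sesq p (ch f) (w f)))"
  proof (rule integral_mono)
    show "integrable lborel (\<lambda>f. m * (\<Sum>k<p. ?I f k))"
      by (intro integrable_mult_right Bochner_Integration.integrable_sum I)
    show "integrable lborel (\<lambda>f. Re (sesq p (ch f) (w f)))" by (rule integrable.intros[OF int])
    \<comment> \<open>On the ball this is \<open>low\<close>; elsewhere the left side vanishes and
      \<open>psd\<close> suffices.\<close>
    show "m * (\<Sum>k<p. ?I f k) \<le> Re (sesq p (ch f) (w f))" for f
      using low[of f "w f"] psd[of f "w f"] by (cases "f \<in> cball 0 R") auto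
  qed
  also have "\<dots> = Re (\<Sum>a\<in>S. \<Sum>b\<in>S. cnj (v a) * v b * complex_of_real (c (\<kappa> a) (\<kappa> b) (y a - y b)))"
    by (rule has_bochner_integral_integral_eq[OF int])
  finally show ?thesis .
qed

subsection \<open>Smallest eigenvalues and block indices\<close>

lemma ordered_eigenvalue_1_le:
  assumes A: "A \<in> carrier_mat n n" and e: "eigenvalue A \<mu>"
  shows "ordered_eigenvalue 1 A \<le> Re \<mu>"
proof -
  let ?L = "sorted_list_of_multiset (image_mset Re (proots (char_poly A)))"
  have nz: "char_poly A \<noteq> 0" using degree_monic_char_poly[OF A] by auto
  have "poly (char_poly A) \<mu> = 0" using e eigenvalue_root_char_poly[OF A] by simp
  then have "Re \<mu> \<in> set ?L" using nz by auto
  moreover have "sorted ?L" by simp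
  ultimately show ?thesis by (cases ?L) (auto simp: ordered_eigenvalue_def)
qed

text \<open>Over the complex numbers the characteristic polynomial has \<open>n\<close> roots with
  multiplicity, so for \<open>n > 0\<close> the sorted list has an entry at position 0 and the
  access is not a default value.\<close>

lemma ordered_eigenvalue_1_is_eigenvalue:
  assumes A: "A \<in> carrier_mat n n" and n: "n > 0"
  shows "\<exists>\<mu>. eigenvalue A \<mu> \<and> ordered_eigenvalue 1 A = Re \<mu>"
proof -
  let ?L = "sorted_list_of_multiset (image_mset Re (proots (char_poly A)))"
  have nz: "char_poly A \<noteq> 0" using degree_monic_char_poly[OF A] by auto
  have "size (proots (char_poly A)) = n" using degree_monic_char_poly[OF A] by (simp add: size_proots_complex)
  then have "length ?L = n" by (metis mset_sorted_list_of_multiset size_image_mset size_mset)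
  then have "?L ! 0 \<in> set ?L" using n by (intro nth_mem) simp
  then have "?L ! 0 \<in> Re ` {x. poly (char_poly A) x = 0}" using nz by simp
  then show ?thesis using eigenvalue_root_char_poly[OF A] by (auto simp: ordered_eigenvalue_def)
qed

text \<open>Bridge between the matrix library and the vectors as functions used for
  \<open>sesq\<close>.\<close>

lemma eigenvalue_iff_sum:
  assumes A: "A \<in> carrier_mat n n"
  shows "eigenvalue A \<mu> \<longleftrightarrow> (\<exists>w. (\<exists>k<n. w k \<noteq> 0) \<and> (\<forall>k<n. (\<Sum>l<n. A $$ (k, l) * w l) = \<mu> * w k))"
proof
  assume "eigenvalue A \<mu>"
  then obtain v where v: "v \<in> carrier_vec n" "v \<noteq> 0\<^sub>v n" "A *\<^sub>v v = \<mu> \<cdot>\<^sub>v v"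
    using A by (auto simp: eigenvalue_def eigenvector_def)
  have "(\<Sum>l<n. A $$ (k, l) * vec_index v l) = \<mu> * vec_index v k" if k: "k < n" for k
  proof -
    have "vec_index (A *\<^sub>v v) k = vec_index (\<mu> \<cdot>\<^sub>v v) k" by (simp add: v(3))
    then show ?thesis using A v(1) k by (simp add: scalar_prod_def lessThan_atLeast0)
  qed
  moreover have "\<exists>k<n. vec_index v k \<noteq> 0"
  proof (rule ccontr)
    assume "\<not> (\<exists>k<n. vec_index v k \<noteq> 0)"
    then have "v = 0\<^sub>v n" using v(1) by (intro eq_vecI) auto
    then show False using v(2) by simp
  qed
  ultimately show "\<exists>w. (\<exists>k<n. w k \<noteq> 0) \<and> (\<forall>k<n. (\<Sum>l<n. A $$ (k, l) * w l) = \<mu> * w k)" by blast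
next
  assume "\<exists>w. (\<exists>k<n. w k \<noteq> 0) \<and> (\<forall>k<n. (\<Sum>l<n. A $$ (k, l) * w l) = \<mu> * w k)"
  then obtain w where w: "\<exists>k<n. w k \<noteq> 0" "\<And>k. k < n \<Longrightarrow> (\<Sum>l<n. A $$ (k, l) * w l) = \<mu> * w k" by blast
  have "Matrix.vec n w \<noteq> 0\<^sub>v n"
  proof
    assume "Matrix.vec n w = 0\<^sub>v n"
    then have "vec_index (Matrix.vec n w) k = vec_index (0\<^sub>v n) k" for k by simp
    then have "w k = 0" if "k < n" for k using that by (metis index_vec index_zero_vec(1))
    then show False using w(1) by blast
  qed
  moreover have "A *\<^sub>v Matrix.vec n w = \<mu> \<cdot>\<^sub>v Matrix.vec n w"
    using A w(2) by (intro eq_vecI) (auto simp: scalar_prod_def lessThan_atLeast0)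
  ultimately show "eigenvalue A \<mu>"
    using A by (auto simp: eigenvalue_def eigenvector_def intro!: exI[of _ "Matrix.vec n w"])
qed

text \<open>Test the form on an eigenvector: its value is the eigenvalue times the squared norm, and
  the squared norm is positive.\<close>

lemma ordered_eigenvalue_1_ge:
  assumes A: "A \<in> carrier_mat n n" and n: "n > 0"
    and low: "\<And>w. \<delta> * (\<Sum>k<n. (cmod (w k))\<^sup>2) \<le> Re (sesq n (\<lambda>k l. A $$ (k, l)) w)"
  shows "\<delta> \<le> ordered_eigenvalue 1 A"
proof -
  obtain \<mu> where \<mu>: "eigenvalue A \<mu>" "ordered_eigenvalue 1 A = Re \<mu>"
    using ordered_eigenvalue_1_is_eigenvalue[OF A n] by blast
  obtain w where w: "\<exists>k<n. w k \<noteq> 0" "\<And>k. k < n \<Longrightarrow> (\<Sum>l<n. A $$ (k, l) * w l) = \<mu> * w k"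
    using \<mu>(1) unfolding eigenvalue_iff_sum[OF A] by blast
  define N where "N = (\<Sum>k<n. (cmod (w k))\<^sup>2)"
  have "sesq n (\<lambda>k l. A $$ (k, l)) w = (\<Sum>k<n. \<mu> * of_real ((cmod (w k))\<^sup>2))"
    unfolding sesq_eq
  proof (intro sum.cong refl)
    fix k assume "k \<in> {..<n}"
    then have "cnj (w k) * (\<Sum>l<n. A $$ (k, l) * w l) = cnj (w k) * (\<mu> * w k)" using w(2)[of k] by simp
    then show "cnj (w k) * (\<Sum>l<n. A $$ (k, l) * w l) = \<mu> * of_real ((cmod (w k))\<^sup>2)"
      unfolding complex_norm_square by (simp only: mult_ac)
  qed
  also have "\<dots> = \<mu> * of_real N" by (simp add: N_def sum_distrib_left)
  finally have "\<delta> * N \<le> Re \<mu> * N" using low[of w] by (simp add: N_def[symmetric])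
  moreover have "N > 0"
  proof -
    obtain k where k: "k < n" "w k \<noteq> 0" using w(1) by blast
    have "0 < (cmod (w k))\<^sup>2" using k by simp
    also have "\<dots> \<le> N" unfolding N_def using k by (intro member_le_sum) auto
    finally show ?thesis .
  qed
  ultimately show ?thesis using \<mu>(2) by simp
qed

section \<open>Decoding a row number into component and offset\<close>

lemma block_index_bounds:
  assumes "a \<ge> 1" "a \<le> block_end n p"
  shows "block_index n a \<in> {1..p}" "block_end n (block_index n a - 1) < a"
proof -
  let ?k = "block_index n a"
  have le: "a \<le> block_end n ?k" unfolding block_index_def using assms(2) by (rule LeastI)
  have kp: "?k \<le> p" unfolding block_index_def using assms(2) by (rule Least_le)
  have k1: "?k \<ge> 1"
  proof (rule ccontr)
    assume "\<not> ?k \<ge> 1"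
    then have "?k = 0" by simp
    with le have "a \<le> block_end n 0" by simp
    then show False using assms(1) by (simp add: block_end_def)
  qed
  show "?k \<in> {1..p}" using kp k1 by simp
  have "\<not> a \<le> block_end n (?k - 1)"
  proof
    assume "a \<le> block_end n (?k - 1)"
    then have "?k \<le> ?k - 1" unfolding block_index_def by (rule Least_le)
    then show False using k1 by simp
  qed
  then show "block_end n (?k - 1) < a" by simp
qed

lemma block_position:
  assumes "a \<ge> 1" "a \<le> block_end n p"
  shows "a = block_end n (block_index n a - 1) + block_offset n a" "block_offset n a \<ge> 1"
  using block_index_bounds(2)[OF assms] by (simp_all add: block_offset_def)

section \<open>The bound that is uniform in the sample sizes\<close>

theorem theorem4:
  fixes p :: nat
    and M :: "'w measure"
    and Z :: "nat \<Rightarrow> real^'d \<Rightarrow> 'w \<Rightarrow> real"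
    and c :: "nat \<Rightarrow> nat \<Rightarrow> real^'d \<Rightarrow> real"
    and x :: "nat \<Rightarrow> nat \<Rightarrow> real^'d"
  assumes p: "p \<ge> 1"
    and cov: "is_matrix_covariance_function M p Z c"
    and decay: "\<exists>A \<tau> :: real. A > 0 \<and> \<tau> > 0 \<and>
      (\<forall>k\<in>{1..p}. \<forall>l\<in>{1..p}. \<forall>y.
         \<bar>c k l y\<bar> \<le> A / (1 + infnorm y powr (real CARD('d) + \<tau>)))"
    and inversion: "\<forall>k\<in>{1..p}. \<forall>l\<in>{1..p}. \<forall>y.
      has_bochner_integral lborel
        (\<lambda>f. fourier (c k l) f * exp (\<i> * complex_of_real (inner f y)))
        (complex_of_real (c k l y))"
    and spectral_pos: "\<forall>f. ordered_eigenvalue 1 (spectral_matrix p c f) > 0"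
    and separated: "\<exists>\<Delta>>0. \<forall>k\<in>{1..p}.
      (INF (i, j)\<in>{(i, j). 1 \<le> i \<and> 1 \<le> j \<and> i \<noteq> j}. infnorm (x k i - x k j)) \<ge> \<Delta>"
  shows "(INF n\<in>{n. \<forall>k\<in>{1..p}. 1 \<le> n k}.
            ereal (ordered_eigenvalue 1 (map_mat complex_of_real (cov_matrix p c x n)))) > 0"
proof -
  obtain A \<tau> where \<tau>: "\<tau> > 0" and dec: "\<And>k l y. k \<in> {1..p} \<Longrightarrow> l \<in> {1..p} \<Longrightarrow>
      \<bar>c k l y\<bar> \<le> A / (1 + infnorm y powr (real CARD('d) + \<tau>))"
    using decay by blast
  \<comment> \<open>Components are numbered from 1 and matrix rows from 0; \<open>c0\<close> absorbs
    the shift.\<close>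
  define c0 where "c0 k l = c (k + 1) (l + 1)" for k l
  define ch where "ch f k l = fourier (c0 k l) f" for f k l
  have idx: "k + 1 \<in> {1..p}" if "k < p" for k using that by auto
  have inv: "has_bochner_integral lborel
        (\<lambda>f. ch f k l * exp (\<i> * complex_of_real (inner f y))) (complex_of_real (c0 k l y))"
    if "k < p" "l < p" for k l y
    using inversion idx[OF that(1)] idx[OF that(2)] unfolding ch_def c0_def by blast
  have int: "integrable lborel (c0 k l)" if "k < p" "l < p" for k l
    using dec[OF idx[OF that(1)] idx[OF that(2)]] inv[OF that]
    unfolding ch_def by (intro integrable_of_fourier_inversion[OF \<tau>]) (auto simp: c0_def)
  have herm: "ch f l k = cnj (ch f k l)" if "k < p" "l < p" for f k l
  proof -
    have "c0 l k = (\<lambda>h. c0 k l (- h))"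
      unfolding c0_def using covariance_function_reflect[OF cov idx[OF that(1)] idx[OF that(2)]] by blast
    moreover have "c0 k l \<in> borel_measurable borel" using int[OF that] by auto
    ultimately show ?thesis unfolding ch_def by (simp add: fourier_reflect)
  qed
  have cont: "continuous_on K (\<lambda>f. ch f k l)" if "k < p" "l < p" for K k l
    unfolding ch_def using continuous_on_fourier[OF int[OF that]] by (rule continuous_on_subset) simp
  \<comment> \<open>Every real eigenvalue of the spectral matrix is at least its first ordered
    eigenvalue, which is positive by hypothesis.\<close>
  have eig: "m > 0" if w: "\<exists>k<p. w k \<noteq> 0"
    "\<And>k. k < p \<Longrightarrow> (\<Sum>l<p. ch f k l * w l) = complex_of_real m * w k" for f m w
  proof -
    have car: "spectral_matrix p c f \<in> carrier_mat p p" by (simp add: spectral_matrix_def)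
    have "spectral_matrix p c f $$ (k, l) = ch f k l" if "k < p" "l < p" for k l
      using that by (simp add: spectral_matrix_def ch_def c0_def)
    then have "eigenvalue (spectral_matrix p c f) (complex_of_real m)"
      unfolding eigenvalue_iff_sum[OF car] using w by (intro exI[of _ w]) simp
    from ordered_eigenvalue_1_le[OF car this] spectral_pos show ?thesis
      by (metis Re_complex_of_real less_le_trans)
  qed
  have unif: "\<exists>m>0. \<forall>f\<in>K. \<forall>w. m * (\<Sum>k<p. (cmod (w k))\<^sup>2) \<le> Re (sesq p (ch f) w)"
    if "compact K" "K \<noteq> {}" for K
    by (rule hermitian_uniform_lower_bound[OF p that]) (use cont herm eig in blast)+
  \<comment> \<open>The uniform bound on the compact set \<open>{f}\<close> already gives
    nonnegativity at every single frequency.\<close>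
  have psd: "0 \<le> Re (sesq p (ch f) w)" for f w
  proof -
    obtain m where "m > 0" "m * (\<Sum>k<p. (cmod (w k))\<^sup>2) \<le> Re (sesq p (ch f) w)"
      using unif[of "{f}"] by auto
    moreover have "0 \<le> m * (\<Sum>k<p. (cmod (w k))\<^sup>2)" using \<open>m > 0\<close> by (simp add: sum_nonneg)
    ultimately show ?thesis by linarith
  qed
  obtain \<Delta> where \<Delta>: "\<Delta> > 0" and INF: "\<And>k. k \<in> {1..p} \<Longrightarrow>
      (INF (i, j)\<in>{(i, j). 1 \<le> i \<and> 1 \<le> j \<and> i \<noteq> j}. infnorm (x k i - x k j)) \<ge> \<Delta>"
    using separated by blast
  have sep: "\<Delta> \<le> norm (x k i - x k j)" if "k \<in> {1..p}" "1 \<le> i" "1 \<le> j" "i \<noteq> j" for k i j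
  proof -
    \<comment> \<open>An infimum of reals is a lower bound only for a set bounded below; here 0
      works. Afterwards separation passes from the maximum norm to the larger Euclidean
      norm.\<close>
    have "bdd_below ((\<lambda>(i, j). infnorm (x k i - x k j)) ` {(i, j). 1 \<le> i \<and> 1 \<le> j \<and> i \<noteq> j})"
      by (intro bdd_belowI[of _ 0]) (auto simp: infnorm_pos_le)
    from cINF_lower[OF this, of "(i, j)"] INF[OF that(1)] that
    have "\<Delta> \<le> infnorm (x k i - x k j)" by simp
    also have "\<dots> \<le> norm (x k i - x k j)" by (rule infnorm_le_norm)
    finally show ?thesis .
  qed
  \<comment> \<open>\<open>R\<close> and \<gamma> come from \<Delta> alone, and \<open>m\<close>
    below from \<open>R\<close> and the spectral matrix. All three are fixed before the sample sizes
    \<open>n\<close> appear.\<close>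
  obtain R \<gamma> where R: "R \<ge> 0" and \<gamma>: "\<gamma> > 0" and ing: "\<And>S (y :: nat \<Rightarrow> real^'d) v. finite S \<Longrightarrow>
     (\<forall>i\<in>S. \<forall>j\<in>S. i \<noteq> j \<longrightarrow> \<Delta> \<le> norm (y i - y j)) \<Longrightarrow>
     \<gamma> * (\<Sum>i\<in>S. (cmod (v i))\<^sup>2) \<le> (LINT f|lborel. indicator (cball 0 R) f *
        (cmod (\<Sum>i\<in>S. v i * exp (- \<i> * complex_of_real (inner f (y i)))))\<^sup>2)"
    using exponential_sum_lower_bound[OF \<Delta>, where 'i=nat and 'a="real^'d"] by blast
  obtain m where m: "m > 0" and low: "\<And>f w. f \<in> cball 0 R \<Longrightarrow>
      m * (\<Sum>k<p. (cmod (w k))\<^sup>2) \<le> Re (sesq p (ch f) w)"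
    using unif[of "cball 0 R"] R by auto
  have "m * \<gamma> \<le> ordered_eigenvalue 1 (map_mat complex_of_real (cov_matrix p c x n))"
    if n: "\<forall>k\<in>{1..p}. 1 \<le> n k" for n
  proof -
    define N where "N = block_end n p"
    define B where "B = map_mat complex_of_real (cov_matrix p c x n)"
    \<comment> \<open>Rows are counted from 0 but block positions from 1, hence
      \<open>a + 1\<close>. The component \<open>bk\<close> is shifted back to start at 0, while the
      offset \<open>bo\<close> keeps starting at 1 as the points do.\<close>
    define bk where "bk a = block_index n (a + 1) - 1" for a
    define bo where "bo a = block_offset n (a + 1)" for a
    define y where "y a = x (bk a + 1) (bo a)" for a
    have B: "B \<in> carrier_mat N N" by (simp add: B_def N_def cov_matrix_def)
    have "1 \<le> n p" using n p by auto
    also have "n p \<le> N" unfolding N_def using block_end_pred[OF p, of n] by simp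
    finally have N: "N > 0" by simp
    have pos: "bk a < p" "bk a + 1 = block_index n (a + 1)" "bo a \<ge> 1"
      "a + 1 = block_end n (bk a) + bo a" if "a < N" for a
    proof -
      have a: "a + 1 \<ge> 1" "a + 1 \<le> block_end n p" using that by (auto simp: N_def)
      note k = block_index_bounds(1)[OF a]
      show "bk a < p" "bk a + 1 = block_index n (a + 1)" using k by (auto simp: bk_def)
      show "bo a \<ge> 1" "a + 1 = block_end n (bk a) + bo a"
        using block_position[OF a] unfolding bk_def bo_def by auto
    qed
    have entry: "B $$ (a, b) = complex_of_real (c0 (bk a) (bk b) (y a - y b))" if "a < N" "b < N" for a b
      using that pos(2)[OF that(1)] pos(2)[OF that(2)]
      by (simp add: B_def cov_matrix_def N_def Let_def c0_def y_def bo_def del: Suc_eq_plus1)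
    have ysep: "\<Delta> \<le> norm (y a - y b)" if "a < N" "b < N" "a \<noteq> b" "bk a = bk b" for a b
    proof -
      \<comment> \<open>Distinct rows of one block differ in their offsets, so they belong to
        distinct members of one sequence.\<close>
      have "bo a \<noteq> bo b" using pos(4)[OF that(1)] pos(4)[OF that(2)] that(3,4) by auto
      then show ?thesis
        unfolding y_def that(4) using pos[OF that(1)] pos[OF that(2)] idx[of "bk b"] by (intro sep) auto
    qed
    have "m * \<gamma> * (\<Sum>a<N. (cmod (v a))\<^sup>2) \<le> Re (sesq N (\<lambda>a b. B $$ (a, b)) v)" for v
    proof -
      have "m * \<gamma> * (\<Sum>a<N. (cmod (v a))\<^sup>2)
        \<le> Re (\<Sum>a<N. \<Sum>b<N. cnj (v a) * v b * complex_of_real (c0 (bk a) (bk b) (y a - y b)))"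
      proof (rule spectral_quadratic_form_bound[where p=p and ch=ch and R=R, OF _ _ inv psd _ low])
        fix k
        show "\<gamma> * (\<Sum>a | a \<in> {..<N} \<and> bk a = k. (cmod (v a))\<^sup>2)
          \<le> (LINT f|lborel. indicator (cball 0 R) f *
           (cmod (\<Sum>a | a \<in> {..<N} \<and> bk a = k. v a * exp (- \<i> * complex_of_real (inner f (y a)))))\<^sup>2)"
          by (rule ing) (auto intro: ysep)
      qed (use m pos(1) in auto)
      also have "(\<Sum>a<N. \<Sum>b<N. cnj (v a) * v b * complex_of_real (c0 (bk a) (bk b) (y a - y b)))
        = sesq N (\<lambda>a b. B $$ (a, b)) v"
        unfolding sesq_def by (intro sum.cong refl) (simp add: entry mult_ac)
      finally show ?thesis .
    qed
    from ordered_eigenvalue_1_ge[OF B N this] show ?thesis by (simp add: B_def)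
  qed
  then have "ereal (m * \<gamma>) \<le> (INF n\<in>{n. \<forall>k\<in>{1..p}. 1 \<le> n k}.
            ereal (ordered_eigenvalue 1 (map_mat complex_of_real (cov_matrix p c x n))))"
    by (intro INF_greatest) auto
  moreover have "0 < ereal (m * \<gamma>)" using m \<gamma> by simp
  ultimately show ?thesis by (rule less_le_trans[rotated])
qed

end
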